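(* Let $\lambda\ge 0$, $\eta$ and $\alpha_1,\dots,\alpha_\lambda$ be integers with $0<\alpha_1<\cdots<\alpha_\lambda<\eta$ and $\alpha_i=\eta-\alpha_{\lambda+1-i}$ for $1\le i\le\lambda$, and let $k,r$ be integers with $k\ge r\ge\lambda\ge0$ and $0\le\lambda<k-1$. Let $\chi(r=k)=1$ if $r=k$ and $0$ otherwise. There is a bijection $\Phi_0:\mathcal{D}_\eta\times\mathcal{B}_1(\alpha_1,\ldots,\alpha_\lambda;\eta,k-1,r-\chi(r=k))\to\overline{\mathcal{B}}_0(\alpha_1,\ldots,\alpha_\lambda;\eta,k,r)$ such that $|\Phi_0(\zeta,\mu)|=|\zeta|+|\mu|$ for all $(\zeta,\mu)$.
   Context: Overpartitions: the first occurrence of a part size may be overlined. Parts are ordered $1<\bar1<2<\bar2<\cdots$; $\pi=(\pi_1,\dots,\pi_s)$ with $\pi_1\ge\cdots\ge\pi_s$ in this order; inequalities between parts are in this order, and $x\pm\eta$ is the part of size $|x|\pm\eta$ overlined iff $x$ is. $[x/\eta]=\lfloor|x|/\eta\rfloor$; $\overline{V}_\pi(N)$ is the number of overlined parts of $\pi$ that are $\le N$; $|\pi|$ is the sum of the part sizes. For $j\in\{0,1\}$ and parameters $K,R$, $\overline{\mathcal{B}}_j(\alpha_1,\ldots,\alpha_\lambda;\eta,K,R)$ is the set of overpartitions $\pi=(\pi_1,\dots,\pi_s)$ (of any size) such that: (1) every part has size $\equiv 0,\alpha_1,\ldots,\alpha_\lambda\pmod\eta$; (2) only parts whose size is a multiple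 of $\eta$ may be non-overlined; (3) $\pi_i\ge\pi_{i+K-1}+\eta$ whenever $i+K-1\le s$, with strict inequality if $\pi_i$ is non-overlined; (4) at most $R-1$ parts satisfy $\pi_i\le\eta$; (5) whenever $i+K-2\le s$ and $\pi_i\le\pi_{i+K-2}+\eta$ with strict inequality if $\pi_i$ is overlined, then $[\pi_i/\eta]+\cdots+[\pi_{i+K-2}/\eta]\equiv R-1+\overline{V}_\pi(\pi_i)\pmod{2-j}$. The set $\mathcal{B}_j(\alpha_1,\ldots,\alpha_\lambda;\eta,K,R)$ consists of those $\pi\in\overline{\mathcal{B}}_j(\alpha_1,\ldots,\alpha_\lambda;\eta,K,R)$ having no overlined part whose size is a multiple of $\eta$. $\mathcal{D}_\eta$ is the set of partitions (including the empty one) into distinct parts each divisible by $\eta$. *)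

theory Defs
  imports Main "HOL-Library.Product_Lexorder" "HOL-Number_Theory.Cong"
begin

(* A part is (size, overlined).  With False < True, the lexicographic order on pairs is
   1 < overlined 1 < 2 < overlined 2 < ... *)
type_synonym part = "nat \<times> bool"

abbreviation part_size :: "part \<Rightarrow> nat" where "part_size \<equiv> fst"
abbreviation overlined :: "part \<Rightarrow> bool" where "overlined \<equiv> snd"

definition part_plus :: "part \<Rightarrow> nat \<Rightarrow> part" where
  "part_plus x \<eta> = (part_size x + \<eta>, overlined x)"

(* Since an overlined part exceeds the non-overlined part of the same size, in a non-increasing
   list an overlined part that is not repeated is the first occurrence of its size. *)
definition overpartition :: "part list \<Rightarrow> bool" where
  "overpartition \<pi> \<longleftrightarrow>
     sorted_wrt (\<ge>) \<pi> \<and> (\<forall>x\<in>set \<pi>. part_size x > 0) \<and>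
     (\<forall>n. count_list \<pi> (n, True) \<le> 1)"

definition weight :: "part list \<Rightarrow> nat" where
  "weight \<pi> = sum_list (map part_size \<pi>)"

definition part_at :: "part list \<Rightarrow> nat \<Rightarrow> part" where  (* 1-based *)
  "part_at \<pi> i = \<pi> ! (i - 1)"

definition V_bar :: "part list \<Rightarrow> part \<Rightarrow> nat" where
  "V_bar \<pi> N = length (filter (\<lambda>x. overlined x \<and> x \<le> N) \<pi>)"

(* A is the set {alpha_1, ..., alpha_lambda}.
   R - 1 is taken over the integers, so that R = 0 makes the fourth condition unsatisfiable.
   The sets are meant for K \<ge> 1 and j \<le> 1.  For K = 1 the indices in the last condition degenerate
   (i + K - 2 = i - 1), which is harmless for j = 1, where the congruence is modulo 1. *)
definition B_bar :: "nat \<Rightarrow> nat set \<Rightarrow> nat \<Rightarrow> nat \<Rightarrow> nat \<Rightarrow> part list set" where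
  "B_bar j A \<eta> K R = {\<pi>. overpartition \<pi> \<and>
     (\<forall>x\<in>set \<pi>. \<exists>a\<in>insert 0 A. [part_size x = a] (mod \<eta>)) \<and>
     (\<forall>x\<in>set \<pi>. \<not> overlined x \<longrightarrow> \<eta> dvd part_size x) \<and>
     (\<forall>i. 1 \<le> i \<and> i \<le> length \<pi> \<and> i + K - 1 \<le> length \<pi> \<longrightarrow>
        part_at \<pi> i \<ge> part_plus (part_at \<pi> (i + K - 1)) \<eta> \<and>
        (\<not> overlined (part_at \<pi> i) \<longrightarrow> part_at \<pi> i > part_plus (part_at \<pi> (i + K - 1)) \<eta>)) \<and>
     int (length (filter (\<lambda>x. x \<le> (\<eta>, False)) \<pi>)) \<le> int R - 1 \<and>
     (\<forall>i. 1 \<le> i \<and> i \<le> length \<pi> \<and> i + K - 2 \<le> length \<pi> \<and>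
        part_at \<pi> i \<le> part_plus (part_at \<pi> (i + K - 2)) \<eta> \<and>
        (overlined (part_at \<pi> i) \<longrightarrow> part_at \<pi> i < part_plus (part_at \<pi> (i + K - 2)) \<eta>) \<longrightarrow>
        [(\<Sum>t = i..i + K - 2. int (part_size (part_at \<pi> t) div \<eta>))
           = int R - 1 + int (V_bar \<pi> (part_at \<pi> i))] (mod (2 - int j)))}"

definition B_set :: "nat \<Rightarrow> nat set \<Rightarrow> nat \<Rightarrow> nat \<Rightarrow> nat \<Rightarrow> part list set" where
  "B_set j A \<eta> K R =
     {\<pi> \<in> B_bar j A \<eta> K R. \<forall>x\<in>set \<pi>. overlined x \<longrightarrow> \<not> \<eta> dvd part_size x}"

definition D_set :: "nat \<Rightarrow> nat list set" where
  "D_set \<eta> = {\<zeta>. sorted_wrt (>) \<zeta> \<and> (\<forall>n\<in>set \<zeta>. n > 0 \<and> \<eta> dvd n)}"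

end

theory Submission
  imports Defs "HOL-Library.Multiset"
begin

text \<open>Cut a list into blocks, the m-th block consisting of the sizes in [m\<eta>, (m+1)\<eta>).  With
  k = c + 2, conditions (3) and (5) together say that every window of parts x - \<eta> .. x ending in
  block m + 1 holds at most c parts, or at most c + 1 if a certain parity test on the number of
  non-overlined copies of (m+1)\<eta> and on the number of overlined parts below succeeds.  On the
  other side the bound is always c.  So the bijection can be done one multiple of \<eta> at a time,
  leaving the other parts and the total number of parts of size m\<eta> unchanged: if the test
  succeeds at m\<eta>, move one of the parts of size m\<eta> to \<zeta> (if there is one); in any case turn
  those that remain into non-overlined parts of \<mu>.  The inverse runs through the multiples of \<eta>
  upwards, since the test needs the overlined parts that were already restored below.\<close>

section \<open>Lists and their multiplicities\<close>

text \<open>The test sees only the block because [y/\<eta>] is m or m + 1 throughout a window ending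
  in block m + 1. The parts counted with m + 1 are the non-overlined copies of (m + 1)\<eta> and the
  overlined parts from there to the end of the window; V counts the latter too, next to the
  overlined parts below. They cancel, so in a full window, which has c + 1 parts, the place where it
  ends drops out. A window ending at an overlined part meets one multiple of \<eta> with all its
  copies, so moving one part exactly when the bound is c + 1 makes the bound c. The difficulty is
  the window ending at the non-overlined (m + 1)\<eta>: it meets two multiples, and of the upper one
  it counts only the non-overlined copies, whose number changes when overlines are removed. The
  bound is preserved nevertheless, because the only value of that number at which the two
  inequalities could disagree has the wrong parity. For m = 0 this window holds the parts counted by
  condition (4), and for r < k the same argument, with r in the constant of the test, preserves that
  condition.\<close>

definition list_of_counts :: "('a::linorder \<Rightarrow> nat) \<Rightarrow> 'a list" where
  "list_of_counts f = rev (sorted_list_of_multiset (Abs_multiset f))"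

lemma count_list_of_counts:
  assumes "finite {y. f y \<noteq> 0}"
  shows "count_list (list_of_counts f) = f"
proof
  fix y
  have "count_list (list_of_counts f) y = count (mset (sorted_list_of_multiset (Abs_multiset f))) y"
    unfolding list_of_counts_def by (simp only: count_mset[symmetric] mset_rev count_list_rev)
  also have "\<dots> = f y"
    using assms by (simp add: count_Abs_multiset)
  finally show "count_list (list_of_counts f) y = f y" .
qed

lemma sorted_list_of_counts: "sorted_wrt (\<ge>) (list_of_counts f)"
  unfolding list_of_counts_def sorted_wrt_rev by simp

lemma eq_if_count_list_eq:
  fixes xs ys :: "'a::linorder list"
  assumes "sorted_wrt (\<ge>) xs" "sorted_wrt (\<ge>) ys" "count_list xs = count_list ys"
  shows "xs = ys"
proof -
  have "mset xs = mset ys"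
    using assms(3) by (simp add: multiset_eq_iff count_mset)
  then have "mset (rev xs) = mset (rev ys)" by simp
  moreover have "sorted (rev xs)" "sorted (rev ys)"
    using assms(1,2) by (simp_all add: sorted_wrt_rev)
  ultimately have "rev xs = rev ys"
    by (metis properties_for_sort)
  then show ?thesis by simp
qed

lemma finite_count_list_support: "finite {y. count_list xs y \<noteq> 0}"
  by (rule finite_subset[of _ "set xs"]) (auto simp: count_list_0_iff)

lemma length_filter_eq_sum_count_list:
  assumes "finite {y. P y}"
  shows "length (filter P xs) = (\<Sum>y | P y. count_list xs y)"
proof (induction xs)
  case (Cons x xs)
  have "(\<Sum>y | P y. count_list (x # xs) y) = (\<Sum>y | P y. count_list xs y + (if x = y then 1 else 0))"
    by (rule sum.cong) auto
  also have "\<dots> = (\<Sum>y | P y. count_list xs y) + (if P x then 1 else 0)"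
    using assms by (simp add: sum.distrib)
  finally show ?case using Cons by simp
qed simp

lemma sum_list_filter_eq_sum_count_list:
  fixes g :: "'a \<Rightarrow> nat"
  assumes "finite {y. P y}"
  shows "sum_list (map g (filter P xs)) = (\<Sum>y | P y. count_list xs y * g y)"
proof (induction xs)
  case (Cons x xs)
  have "(\<Sum>y | P y. count_list (x # xs) y * g y)
      = (\<Sum>y | P y. count_list xs y * g y + (if x = y then g y else 0))"
    by (rule sum.cong) auto
  also have "\<dots> = (\<Sum>y | P y. count_list xs y * g y) + (if P x then g x else 0)"
    using assms by (simp add: sum.distrib)
  finally show ?case using Cons by simp
qed simp

text \<open>Turns sets of lists into sets of multiplicity functions, where altering the copies of
  one size is a pointwise change.\<close>

lemma bij_betw_list_of_counts:
  assumes "\<forall>f\<in>S. finite {y. f y \<noteq> 0}"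
  shows "bij_betw count_list {xs. sorted_wrt (\<ge>) xs \<and> count_list xs \<in> S} S"
    "bij_betw list_of_counts S {xs. sorted_wrt (\<ge>) xs \<and> count_list xs \<in> S}"
proof -
  have 1: "list_of_counts (count_list xs) = xs" if "sorted_wrt (\<ge>) xs" for xs :: "'a list"
    using that
    by (intro eq_if_count_list_eq sorted_list_of_counts count_list_of_counts finite_count_list_support)
  have 2: "count_list (list_of_counts f) = f" if "f \<in> S" for f
    using that assms by (intro count_list_of_counts) auto
  show "bij_betw count_list {xs. sorted_wrt (\<ge>) xs \<and> count_list xs \<in> S} S"
    by (rule bij_betw_byWitness[where f' = list_of_counts])
      (use 1 2 sorted_list_of_counts in auto)
  show "bij_betw list_of_counts S {xs. sorted_wrt (\<ge>) xs \<and> count_list xs \<in> S}"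
    by (rule bij_betw_byWitness[where f' = count_list])
      (use 1 2 sorted_list_of_counts in auto)
qed

text \<open>\<open>N\<close> is an arbitrary bound, so that the sums for \<zeta>, \<mu> and the
  image can later run over one index set.\<close>

lemma sum_list_eq_sum_count_list:
  assumes "\<forall>n\<in>set \<zeta>. n \<le> N"
  shows "sum_list \<zeta> = (\<Sum>n\<le>N. count_list \<zeta> n * n)"
proof -
  have "filter (\<lambda>n. n \<le> N) \<zeta> = \<zeta>" using assms by (simp add: filter_id_conv)
  then show ?thesis
    using sum_list_filter_eq_sum_count_list[of "\<lambda>n. n \<le> N" "\<lambda>n. n" \<zeta>] by (simp add: atMost_def)
qed

lemma weight_eq_sum_count_list:
  assumes "\<forall>y\<in>set \<pi>. fst y \<le> N"
  shows "weight \<pi> = (\<Sum>n\<le>N. (count_list \<pi> (n, False) + count_list \<pi> (n, True)) * n)"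
proof -
  have eq: "{y :: part. fst y \<le> N} = {..N} \<times> UNIV" by auto
  have "filter (\<lambda>y. fst y \<le> N) \<pi> = \<pi>" using assms by (simp add: filter_id_conv)
  then have "weight \<pi> = (\<Sum>y | fst y \<le> N. count_list \<pi> y * fst y)"
    using sum_list_filter_eq_sum_count_list[of "\<lambda>y. fst y \<le> N" fst \<pi>]
    by (simp add: weight_def eq)
  also have "\<dots> = (\<Sum>n\<le>N. \<Sum>v\<in>UNIV. count_list \<pi> (n, v) * n)"
    unfolding eq sum.cartesian_product by (rule sum.cong) auto
  finally show ?thesis by (simp add: UNIV_bool algebra_simps)
qed

lemma distinct_sorted_iff:
  fixes xs :: "'a::linorder list"
  shows "sorted_wrt (>) xs \<longleftrightarrow> sorted_wrt (\<ge>) xs \<and> (\<forall>x. count_list xs x \<le> 1)"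
proof (induction xs)
  case (Cons x xs)
  show ?case
  proof
    assume *: "sorted_wrt (>) (x # xs)"
    then have "x \<notin> set xs" by auto
    then show "sorted_wrt (\<ge>) (x # xs) \<and> (\<forall>y. count_list (x # xs) y \<le> 1)"
      using * Cons by (auto simp: count_list_0_iff)
  next
    assume *: "sorted_wrt (\<ge>) (x # xs) \<and> (\<forall>y. count_list (x # xs) y \<le> 1)"
    then have "count_list (x # xs) x \<le> 1" by blast
    then have x: "x \<notin> set xs" by (simp add: count_list_0_iff)
    have "count_list xs y \<le> 1" for y
      using *[THEN conjunct2, rule_format, of y] by (simp split: if_splits)
    then show "sorted_wrt (>) (x # xs)" using * x Cons by (auto simp: less_le)
  qed
qed simp

section \<open>Windows\<close>

text \<open>Condition (3) says that \<open>part_at \<pi> (i + K - 1)\<close> does not lie in the window of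
  \<open>part_at \<pi> i\<close>; the premise of condition (5) says that \<open>part_at \<pi> (i + K - 2)\<close> does.\<close>

definition window :: "nat \<Rightarrow> part \<Rightarrow> part set" where
  "window \<eta> x = {y. y \<le> x \<and> x \<le> part_plus y \<eta> \<and> (overlined x \<longrightarrow> x < part_plus y \<eta>)}"

lemma finite_le_part: "finite {y :: part. y \<le> x}"
  by (rule finite_subset[of _ "{..fst x} \<times> UNIV"]) (auto simp: less_eq_prod_def)

lemma finite_window: "finite (window \<eta> x)"
  by (rule finite_subset[OF _ finite_le_part[of x]]) (auto simp: window_def)

lemma part_plus_mono: "z \<le> y \<Longrightarrow> part_plus z \<eta> \<le> part_plus y \<eta>"
  unfolding part_plus_def less_eq_prod_def by auto

text \<open>Lets the window of an arbitrary \<open>x\<close> be replaced by that of the largest part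
  in it. If \<open>y\<close> differs from \<open>x\<close>, then y < x makes the inequality strict
  whether or not \<open>y\<close> is overlined.\<close>

lemma window_mono:
  assumes "y \<in> window \<eta> x" "z \<in> window \<eta> x" "z \<le> y"
  shows "z \<in> window \<eta> y"
proof -
  have "y \<le> x" "x \<le> part_plus z \<eta>" "overlined x \<longrightarrow> x < part_plus z \<eta>"
    using assms by (simp_all add: window_def)
  then have "y \<le> part_plus z \<eta> \<and> (overlined y \<longrightarrow> y < part_plus z \<eta>)"
    by (cases "y = x") auto
  then show ?thesis using assms(3) by (simp add: window_def)
qed

lemma window_between:
  assumes "z \<in> window \<eta> x" "z \<le> y" "y \<le> x"
  shows "y \<in> window \<eta> x"
  using assms part_plus_mono[OF assms(2), of \<eta>] unfolding window_def by auto

lemma sorted_split: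
  fixes xs :: "'a::linorder list"
  assumes "sorted_wrt (\<ge>) xs" "\<And>x y. P y \<Longrightarrow> y \<le> x \<Longrightarrow> P x"
  shows "xs = filter P xs @ filter (\<lambda>x. \<not> P x) xs"
  using assms(1)
proof (induction xs)
  case (Cons x xs)
  show ?case
  proof (cases "P x")
    case False
    then have "\<forall>y\<in>set xs. \<not> P y" using Cons.prems assms(2) by auto
    then show ?thesis using False by (simp add: filter_False)
  qed (use Cons in auto)
qed simp

text \<open>A window is an interval of the order, cut out by two upward closed predicates: exceeding
  \<open>x\<close>, and, among the remaining parts, reaching \<open>x\<close> within \<eta>.\<close>

lemma sorted_window_split:
  assumes "sorted_wrt (\<ge>) \<pi>"
  obtains H L where "\<pi> = H @ filter (\<lambda>y. y \<in> window \<eta> x) \<pi> @ L"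
    "\<forall>y\<in>set H. y > x" "\<forall>y\<in>set L. y \<le> x"
proof -
  let ?H = "filter (\<lambda>y. y > x) \<pi>" and ?M = "filter (\<lambda>y. \<not> y > x) \<pi>"
  have 1: "\<pi> = ?H @ ?M" by (rule sorted_split[OF assms]) auto
  have sM: "sorted_wrt (\<ge>) ?M" using assms by (rule sorted_wrt_filter)
  let ?Q = "\<lambda>y. x \<le> part_plus y \<eta> \<and> (overlined x \<longrightarrow> x < part_plus y \<eta>)"
  have 2: "?M = filter ?Q ?M @ filter (\<lambda>y. \<not> ?Q y) ?M"
    by (rule sorted_split[OF sM]) (auto simp: part_plus_def less_eq_prod_def less_prod_def)
  have 3: "filter ?Q ?M = filter (\<lambda>y. y \<in> window \<eta> x) \<pi>"
    unfolding filter_filter by (rule filter_cong) (auto simp: window_def)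
  show ?thesis
  proof (rule that)
    show "\<pi> = ?H @ filter (\<lambda>y. y \<in> window \<eta> x) \<pi> @ filter (\<lambda>y. \<not> ?Q y) ?M"
      using 1 2 unfolding 3 by argo
  qed auto
qed

lemma run_in_window:
  assumes "sorted_wrt (\<ge>) \<pi>" "1 \<le> i" "i + n \<le> length \<pi>"
    and "part_at \<pi> (i + n) \<in> window \<eta> (part_at \<pi> i)"
  shows "\<forall>y\<in>set (take (n + 1) (drop (i - 1) \<pi>)). y \<in> window \<eta> (part_at \<pi> i)"
proof
  fix y assume "y \<in> set (take (n + 1) (drop (i - 1) \<pi>))"
  then obtain j where j: "j < n + 1" "y = \<pi> ! (i - 1 + j)"
    using assms(2,3) by (auto simp: in_set_conv_nth)
  have le: "\<pi> ! q \<le> \<pi> ! p" if "p \<le> q" "q < length \<pi>" for p q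
    using that assms(1) by (metis le_neq_implies_less order_refl sorted_wrt_iff_nth_less)
  show "y \<in> window \<eta> (part_at \<pi> i)"
  proof (rule window_between[OF assms(4)])
    show "part_at \<pi> (i + n) \<le> y" unfolding part_at_def j(2)
      by (rule le) (use assms j in auto)
    show "y \<le> part_at \<pi> i" unfolding part_at_def j(2)
      by (rule le) (use assms j in auto)
  qed
qed

lemma run_split:
  assumes "1 \<le> i" "i + n \<le> length xs"
  obtains us ws where "xs = us @ take (n + 1) (drop (i - 1) xs) @ ws"
    "length (take (n + 1) (drop (i - 1) xs)) = n + 1"
proof
  show "xs = take (i - 1) xs @ take (n + 1) (drop (i - 1) xs) @ drop (n + 1) (drop (i - 1) xs)"
    by (metis append_take_drop_id)
qed (use assms in auto)

lemma sum_part_at: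
  assumes "1 \<le> i" "i + n \<le> length \<pi>"
  shows "(\<Sum>t = i..i + n. g (part_at \<pi> t)) = sum_list (map g (take (n + 1) (drop (i - 1) \<pi>)))"
proof -
  have len: "length (map g (take (n + 1) (drop (i - 1) \<pi>))) = n + 1" using assms by auto
  have "sum_list (map g (take (n + 1) (drop (i - 1) \<pi>)))
      = (\<Sum>t = 0..<n + 1. g (\<pi> ! (i - 1 + t)))"
    unfolding sum_list_sum_nth len
    by (rule sum.cong[OF refl]) (use len in simp)
  also have "\<dots> = (\<Sum>t = i..i + n. g (part_at \<pi> t))"
    unfolding part_at_def
    by (rule sum.reindex_bij_witness[of _ "\<lambda>t. t - i" "\<lambda>t. t + i"])
      (use assms(1) in \<open>auto simp: add.commute\<close>)
  finally show ?thesis by simp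
qed

section \<open>Conditions (3) and (5) in terms of windows\<close>

lemma near_part_at_iff:
  assumes "sorted_wrt (\<ge>) \<pi>" "1 \<le> i" "i \<le> j" "j \<le> length \<pi>"
  shows "part_at \<pi> i \<le> part_plus (part_at \<pi> j) \<eta> \<and>
         (overlined (part_at \<pi> i) \<longrightarrow> part_at \<pi> i < part_plus (part_at \<pi> j) \<eta>)
     \<longleftrightarrow> part_at \<pi> j \<in> window \<eta> (part_at \<pi> i)"
proof -
  have "part_at \<pi> j \<le> part_at \<pi> i"
    unfolding part_at_def using assms
    by (cases "i = j") (auto simp: sorted_wrt_iff_nth_less)
  then show ?thesis by (simp add: window_def)
qed

text \<open>The windows need not end at a part: the parts in the window of any \<open>x\<close> all
  lie in the window of the largest of them. So \<open>Q\<close> may be any predicate that holds for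
  the parts.\<close>

lemma gap_condition_iff:
  assumes srt: "sorted_wrt (\<ge>) \<pi>" and K: "1 \<le> K" and Q: "\<forall>x\<in>set \<pi>. Q x"
  shows "(\<forall>i. 1 \<le> i \<and> i \<le> length \<pi> \<and> i + K - 1 \<le> length \<pi> \<longrightarrow>
        part_at \<pi> i \<ge> part_plus (part_at \<pi> (i + K - 1)) \<eta> \<and>
        (\<not> overlined (part_at \<pi> i) \<longrightarrow> part_at \<pi> i > part_plus (part_at \<pi> (i + K - 1)) \<eta>))
    \<longleftrightarrow> (\<forall>x. Q x \<longrightarrow> length (filter (\<lambda>y. y \<in> window \<eta> x) \<pi>) < K)"
    (is "?gap \<longleftrightarrow> ?win")
proof -
  have gap: "?gap \<longleftrightarrow> (\<forall>i. 1 \<le> i \<and> i + (K - 1) \<le> length \<pi> \<longrightarrow>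
      part_at \<pi> (i + (K - 1)) \<notin> window \<eta> (part_at \<pi> i))"
  proof -
    have "part_at \<pi> i \<ge> part_plus (part_at \<pi> (i + K - 1)) \<eta> \<and>
        (\<not> overlined (part_at \<pi> i) \<longrightarrow> part_at \<pi> i > part_plus (part_at \<pi> (i + K - 1)) \<eta>)
      \<longleftrightarrow> part_at \<pi> (i + (K - 1)) \<notin> window \<eta> (part_at \<pi> i)"
      if "1 \<le> i" "i + (K - 1) \<le> length \<pi>" for i
    proof -
      have e: "i + K - 1 = i + (K - 1)" using K by simp
      show ?thesis unfolding e near_part_at_iff[OF srt that(1) le_add1 that(2), symmetric]
        by (meson linorder_not_less order.strict_implies_order)
    qed
    then show ?thesis using K by auto
  qed
  show ?thesis unfolding gap
  proof (intro iffI allI impI)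
    fix x
    assume g: "\<forall>i. 1 \<le> i \<and> i + (K - 1) \<le> length \<pi> \<longrightarrow>
      part_at \<pi> (i + (K - 1)) \<notin> window \<eta> (part_at \<pi> i)"
    obtain H L where HL: "\<pi> = H @ filter (\<lambda>y. y \<in> window \<eta> x) \<pi> @ L"
      by (rule sorted_window_split[OF srt])
    define M where "M = filter (\<lambda>y. y \<in> window \<eta> x) \<pi>"
    have pi: "\<pi> = H @ M @ L" using HL by (simp add: M_def)
    show "length (filter (\<lambda>y. y \<in> window \<eta> x) \<pi>) < K"
    proof (rule ccontr)
      assume "\<not> ?thesis"
      then have len: "K \<le> length M" by (simp add: M_def)
      have *: "part_at \<pi> (length H + 1) = M ! 0" "part_at \<pi> (length H + 1 + (K - 1)) = M ! (K - 1)"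
        using len K by (auto simp: part_at_def pi nth_append)
      have in_w: "M ! j \<in> window \<eta> x" if "j < length M" for j
        using nth_mem[OF that] by (simp add: M_def)
      have "M ! (K - 1) \<le> M ! 0"
      proof (cases "K = 1")
        case False
        have "sorted_wrt (\<ge>) M" unfolding M_def using srt by (rule sorted_wrt_filter)
        then show ?thesis using False K len by (auto simp: sorted_wrt_iff_nth_less)
      qed simp
      then have "M ! (K - 1) \<in> window \<eta> (M ! 0)"
      proof (rule window_mono[rotated 2])
        show "M ! (K - 1) \<in> window \<eta> x" "M ! 0 \<in> window \<eta> x"
          using len K by (auto intro!: in_w)
      qed
      moreover have "length H + 1 + (K - 1) \<le> length \<pi>" using len K by (simp add: pi)
      ultimately show False using g[rule_format, of "length H + 1"] * by auto
    qed
  next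
    fix i
    assume w: "\<forall>x. Q x \<longrightarrow> length (filter (\<lambda>y. y \<in> window \<eta> x) \<pi>) < K"
      and i: "1 \<le> i \<and> i + (K - 1) \<le> length \<pi>"
    show "part_at \<pi> (i + (K - 1)) \<notin> window \<eta> (part_at \<pi> i)"
    proof
      assume nr: "part_at \<pi> (i + (K - 1)) \<in> window \<eta> (part_at \<pi> i)"
      let ?M = "take (K - 1 + 1) (drop (i - 1) \<pi>)"
      obtain us ws where s: "\<pi> = us @ ?M @ ws" "length ?M = K - 1 + 1"
        using run_split[of i "K - 1" \<pi>] i by blast
      have "filter (\<lambda>y. y \<in> window \<eta> (part_at \<pi> i)) ?M = ?M"
        using run_in_window[OF srt _ _ nr] i by (simp add: filter_id_conv)
      then have "K \<le> length (filter (\<lambda>y. y \<in> window \<eta> (part_at \<pi> i)) (us @ ?M @ ws))"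
        using s(2) K by simp
      then have "K \<le> length (filter (\<lambda>y. y \<in> window \<eta> (part_at \<pi> i)) \<pi>)"
        using s(1) by metis
      moreover have "Q (part_at \<pi> i)" using Q i K by (auto simp: part_at_def)
      ultimately show False using w leD by blast
    qed
  qed
qed

text \<open>As for condition (3), a full window of any \<open>x\<close> is reduced to the window of
  its largest part. The bound \<open>win\<close> makes a full window coincide with a run of K - 1
  consecutive parts.\<close>

lemma parity_condition_iff:
  fixes R :: int
  assumes srt: "sorted_wrt (\<ge>) \<pi>" and K: "2 \<le> K" and Q: "\<forall>x\<in>set \<pi>. Q x"
    and win: "\<forall>x. Q x \<longrightarrow> length (filter (\<lambda>y. y \<in> window \<eta> x) \<pi>) < K"
  shows "(\<forall>i. 1 \<le> i \<and> i \<le> length \<pi> \<and> i + K - 2 \<le> length \<pi> \<and>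
        part_at \<pi> i \<le> part_plus (part_at \<pi> (i + K - 2)) \<eta> \<and>
        (overlined (part_at \<pi> i) \<longrightarrow> part_at \<pi> i < part_plus (part_at \<pi> (i + K - 2)) \<eta>) \<longrightarrow>
        [(\<Sum>t = i..i + K - 2. int (part_size (part_at \<pi> t) div \<eta>))
           = R + int (V_bar \<pi> (part_at \<pi> i))] (mod M))
    \<longleftrightarrow> (\<forall>x. Q x \<longrightarrow> length (filter (\<lambda>y. y \<in> window \<eta> x) \<pi>) = K - 1 \<longrightarrow>
        [int (sum_list (map (\<lambda>y. part_size y div \<eta>) (filter (\<lambda>y. y \<in> window \<eta> x) \<pi>)))
           = R + int (V_bar \<pi> x)] (mod M))"
    (is "?gap \<longleftrightarrow> ?win")
proof -
  let ?run = "\<lambda>i. take (K - 1) (drop (i - 1) \<pi>)"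
  have gap: "?gap \<longleftrightarrow> (\<forall>i. 1 \<le> i \<and> i + (K - 2) \<le> length \<pi> \<and>
      part_at \<pi> (i + (K - 2)) \<in> window \<eta> (part_at \<pi> i) \<longrightarrow>
      [int (sum_list (map (\<lambda>y. part_size y div \<eta>) (?run i)))
           = R + int (V_bar \<pi> (part_at \<pi> i))] (mod M))"
  proof -
    have "part_at \<pi> i \<le> part_plus (part_at \<pi> (i + K - 2)) \<eta> \<and>
        (overlined (part_at \<pi> i) \<longrightarrow> part_at \<pi> i < part_plus (part_at \<pi> (i + K - 2)) \<eta>)
      \<longleftrightarrow> part_at \<pi> (i + (K - 2)) \<in> window \<eta> (part_at \<pi> i)"
      if "1 \<le> i" "i + (K - 2) \<le> length \<pi>" for i
      using near_part_at_iff[OF srt, of i "i + (K - 2)" \<eta>] that K by auto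
    moreover have "(\<Sum>t = i..i + K - 2. int (part_size (part_at \<pi> t) div \<eta>))
        = int (sum_list (map (\<lambda>y. part_size y div \<eta>) (?run i)))"
      if "1 \<le> i" "i + (K - 2) \<le> length \<pi>" for i
    proof -
      have "K - 2 + 1 = K - 1" "i + K - 2 = i + (K - 2)" using K by auto
      then show ?thesis
        using sum_part_at[OF that, of "\<lambda>y. part_size y div \<eta>"]
        by (metis of_nat_sum)
    qed
    moreover have "i + K - 2 = i + (K - 2)" for i using K by simp
    moreover have "i \<le> length \<pi>" if "i + (K - 2) \<le> length \<pi>" for i using that by simp
    ultimately show ?thesis by (smt (verit, best))
  qed
  show ?thesis unfolding gap
  proof (intro iffI allI impI)
    fix x
    assume g: "\<forall>i. 1 \<le> i \<and> i + (K - 2) \<le> length \<pi> \<and>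
      part_at \<pi> (i + (K - 2)) \<in> window \<eta> (part_at \<pi> i) \<longrightarrow>
      [int (sum_list (map (\<lambda>y. part_size y div \<eta>) (?run i)))
           = R + int (V_bar \<pi> (part_at \<pi> i))] (mod M)"
      and len: "length (filter (\<lambda>y. y \<in> window \<eta> x) \<pi>) = K - 1"
    obtain H L where HL: "\<pi> = H @ filter (\<lambda>y. y \<in> window \<eta> x) \<pi> @ L"
      "\<forall>y\<in>set H. y > x" "\<forall>y\<in>set L. y \<le> x"
      by (rule sorted_window_split[OF srt])
    define M' where "M' = filter (\<lambda>y. y \<in> window \<eta> x) \<pi>"
    have pi: "\<pi> = H @ M' @ L" using HL(1) by (simp add: M'_def)
    have lenM: "length M' = K - 1" using len by (simp add: M'_def)
    let ?i = "length H + 1"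
    have *: "part_at \<pi> ?i = M' ! 0" "part_at \<pi> (?i + (K - 2)) = M' ! (K - 2)"
      using lenM K by (auto simp: part_at_def pi nth_append)
    have in_w: "M' ! j \<in> window \<eta> x" if "j < length M'" for j
      using nth_mem[OF that] by (simp add: M'_def)
    have le: "M' ! j \<le> M' ! 0" if "j < length M'" for j
    proof (cases "j = 0")
      case False
      have "sorted_wrt (\<ge>) M'" unfolding M'_def using srt by (rule sorted_wrt_filter)
      then show ?thesis using False that by (auto simp: sorted_wrt_iff_nth_less)
    qed simp
    have "M' ! (K - 2) \<in> window \<eta> (M' ! 0)"
    proof (rule window_mono)
      show "M' ! (K - 2) \<in> window \<eta> x" "M' ! 0 \<in> window \<eta> x"
        using lenM K by (auto intro!: in_w)
      show "M' ! (K - 2) \<le> M' ! 0" using lenM K by (intro le) auto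
    qed
    moreover have "?i + (K - 2) \<le> length \<pi>" using lenM K by (simp add: pi)
    ultimately have "[int (sum_list (map (\<lambda>y. part_size y div \<eta>) (?run ?i)))
           = R + int (V_bar \<pi> (part_at \<pi> ?i))] (mod M)"
      using g[rule_format, of ?i] * by auto
    moreover have "?run ?i = M'" using lenM by (simp add: pi)
    \<comment> \<open>The largest part of the window is the largest part of the list not exceeding
      \<open>x\<close>, so no overlined part lies between the two.\<close>
    moreover have "V_bar \<pi> (part_at \<pi> ?i) = V_bar \<pi> x"
    proof -
      have x0: "M' ! 0 \<le> x" using in_w[of 0] lenM K by (simp add: window_def)
      have "y \<le> M' ! 0" if "y \<in> set \<pi>" "y \<le> x" for y
      proof -
        have "y \<in> set M' \<or> y \<in> set L" using that HL(2) by (auto simp: pi)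
        then show ?thesis
        proof
          assume "y \<in> set M'"
          then show ?thesis using le by (auto simp: in_set_conv_nth)
        next
          assume "y \<in> set L"
          moreover have "M' ! 0 \<in> set M'" using lenM K by simp
          ultimately show ?thesis using srt by (auto simp: pi sorted_wrt_append)
        qed
      qed
      then have "filter (\<lambda>y. overlined y \<and> y \<le> M' ! 0) \<pi> = filter (\<lambda>y. overlined y \<and> y \<le> x) \<pi>"
        using x0 by (intro filter_cong) auto
      then show ?thesis unfolding V_bar_def * by simp
    qed
    ultimately show "[int (sum_list (map (\<lambda>y. part_size y div \<eta>) (filter (\<lambda>y. y \<in> window \<eta> x) \<pi>)))
           = R + int (V_bar \<pi> x)] (mod M)"
      by (simp add: M'_def)
  next
    fix i
    assume w: "\<forall>x. Q x \<longrightarrow> length (filter (\<lambda>y. y \<in> window \<eta> x) \<pi>) = K - 1 \<longrightarrow>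
        [int (sum_list (map (\<lambda>y. part_size y div \<eta>) (filter (\<lambda>y. y \<in> window \<eta> x) \<pi>)))
           = R + int (V_bar \<pi> x)] (mod M)"
      and i: "1 \<le> i \<and> i + (K - 2) \<le> length \<pi> \<and> part_at \<pi> (i + (K - 2)) \<in> window \<eta> (part_at \<pi> i)"
    let ?P = "\<lambda>y. y \<in> window \<eta> (part_at \<pi> i)"
    have K1: "K - 2 + 1 = K - 1" using K by simp
    obtain us ws where s: "\<pi> = us @ ?run i @ ws" "length (?run i) = K - 1"
      using run_split[of i "K - 2" \<pi>] i unfolding K1 by blast
    have fM: "filter ?P (?run i) = ?run i"
      using run_in_window[OF srt, of i "K - 2" \<eta>] i unfolding K1 by (simp add: filter_id_conv)
    have Qi: "Q (part_at \<pi> i)" using Q i K by (auto simp: part_at_def)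
    have eq: "filter ?P \<pi> = filter ?P us @ ?run i @ filter ?P ws"
      using fM s(1) by (metis filter_append)
    \<comment> \<open>The run already supplies K - 1 parts of a window holding fewer than K, so no
      part of the window lies outside it.\<close>
    have "length (filter ?P \<pi>) < K" using win Qi by blast
    then have "length (filter ?P us) + (K - 1) + length (filter ?P ws) < K"
      unfolding eq using s(2) by simp
    then have "length (filter ?P us) = 0" "length (filter ?P ws) = 0" using K by linarith+
    then have "filter ?P us = []" "filter ?P ws = []" by (simp_all only: length_0_conv)
    then have "filter ?P \<pi> = ?run i" using eq by simp
    then show "[int (sum_list (map (\<lambda>y. part_size y div \<eta>) (?run i)))
           = R + int (V_bar \<pi> (part_at \<pi> i))] (mod M)"
      using w[rule_format, OF Qi] s(2) by simp
  qed
qed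

section \<open>Parity of the bounds\<close>

text \<open>With \<open>u = c + d - t - C\<close> the left inequality says \<open>a \<le> u\<close> because \<open>s\<close> and \<open>u\<close> have the same
  parity, and \<open>a + b - x\<close> lies on the same side of \<open>u\<close> as \<open>a\<close>.  For \<open>t < d\<close>, where \<open>t - d\<close> is
  truncated, both sides hold.\<close>

lemma window_bound_step:
  fixes a b C c d s t x :: nat
  assumes "b \<le> 1" "x = (if even (s + a) then 1 else 0)" "d \<le> 1"
    and "even (s + c + d + t + C)" "a + b + C \<le> c + x" "C \<le> c"
  shows "a + t + C \<le> c + x \<longleftrightarrow> (a + b - x) + (t - d) + C \<le> c"
proof (cases "d \<le> t")
  case False
  then show ?thesis using assms(3,5,6) by auto
next
  case True
  then obtain t' where t: "t = t' + d" by (metis le_add_diff_inverse2)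
  have "even (s + (c + t' + C))" using assms(4) unfolding t by presburger
  then have *: "even (s + a) \<longleftrightarrow> even (a + (c + t' + C))" by presburger
  show ?thesis
  proof (cases "even (s + a)")
    case even: True
    then have "a + t' + C \<noteq> c + 1" using * by presburger
    moreover have "x = 1" using even assms(2) by simp
    ultimately show ?thesis using assms(1,3) unfolding t by auto
  next
    case odd: False
    then have "a + t' + C \<noteq> c" using * by presburger
    moreover have "x = 0" using odd assms(2) by simp
    ultimately show ?thesis using assms(1,3) unfolding t by auto
  qed
qed

text \<open>The form of \<open>s\<close> excludes the one value of \<open>a\<close> at which the
  inequalities could differ: a + C = r if x = 1, and a + C + 1 = r if x = 0. For r = c + 2 both
  inequalities follow from the assumed bounds.\<close>

lemma first_bound_step:
  fixes a b C c s x r :: nat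
  assumes "b \<le> 1" "x = (if even (s + a) then 1 else 0)" "s = r + 1 + C"
    and "a + b + C \<le> c + x" "C \<le> c" "r \<le> c + 2"
  shows "a + C + 1 \<le> r \<longleftrightarrow> (a + b - x) + C + 1 \<le> (if r = c + 2 then c + 1 else r)"
proof (cases "r = c + 2")
  case True
  moreover have "x \<le> 1" using assms(2) by simp
  ultimately show ?thesis using assms(4,5) by simp
next
  case False
  show ?thesis
  proof (cases "even (s + a)")
    case even: True
    then have "a + C \<noteq> r" using assms(3) by auto
    moreover have "x = 1" using even assms(2) by simp
    ultimately show ?thesis using False assms(1) by auto
  next
    case odd: False
    then have "a + C + 1 \<noteq> r" using assms(3) by auto
    moreover have "x = 0" using odd assms(2) by simp
    ultimately show ?thesis using False assms(1) by auto
  qed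
qed

text \<open>Whichever of 0 and 1 \<open>z\<close> is, the demand that s + (z + h - b) be even
  exactly when z = 1 says that s + h + b is odd. This forces the overline bit \<open>b\<close>: it
  is 1 iff s + h is even, except that with no copy at all nothing can be overlined.\<close>

lemma remove_insert_step:
  fixes h s z b :: nat
  assumes "z \<le> 1" "b = (if even (s + h) \<and> 0 < z + h then 1 else 0)"
  shows "z + h - (if even (s + (z + h - b)) then 1 else 0) = h"
  using assms by (cases "z = 0"; cases "even (s + h)"; cases "h = 0"; auto)

lemma insert_remove_step:
  fixes a b s x :: nat
  assumes "b \<le> 1" "x = (if even (s + a) then 1 else 0)"
  shows "(if even (s + (a + b - x)) \<and> 0 < a + b then 1 else 0) = b"
  using assms by (cases "b = 0"; cases "even (s + a)"; cases "a = 0"; auto)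

section \<open>Blocks of sizes\<close>

text \<open>\<open>c\<close> is k - 2, so \<open>card_A\<close> expresses \<lambda> < k - 1. The
  case r = 0, where both sides of the bijection are empty, is kept out.\<close>

locale overpartition_params =
  fixes \<eta> c r :: nat and A :: "nat set"
  assumes eta: "0 < \<eta>" and A: "A \<subseteq> {0<..<\<eta>}" and card_A: "card A \<le> c"
    and r: "1 \<le> r" "r \<le> c + 2"
begin

definition admissible :: "(part \<Rightarrow> nat) \<Rightarrow> bool" where
  "admissible f \<longleftrightarrow> finite {y. f y \<noteq> 0} \<and> (\<forall>v. f (0, v) = 0) \<and> (\<forall>n. f (n, True) \<le> 1) \<and>
     (\<forall>n v. f (n, v) \<noteq> 0 \<longrightarrow> n mod \<eta> \<in> insert 0 A) \<and> (\<forall>n. f (n, False) \<noteq> 0 \<longrightarrow> \<eta> dvd n)"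

definition mult_count :: "(part \<Rightarrow> nat) \<Rightarrow> nat \<Rightarrow> nat" where
  "mult_count f m = f (m * \<eta>, False) + f (m * \<eta>, True)"

definition nonmult_window :: "(part \<Rightarrow> nat) \<Rightarrow> part \<Rightarrow> nat" where
  "nonmult_window f x = (\<Sum>y | y \<in> window \<eta> x \<and> \<not> \<eta> dvd fst y. f y)"

definition nonmult_block :: "(part \<Rightarrow> nat) \<Rightarrow> nat \<Rightarrow> nat" where
  "nonmult_block f m = (\<Sum>y | snd y \<and> \<not> \<eta> dvd fst y \<and> fst y div \<eta> = m. f y)"

definition over_count :: "(part \<Rightarrow> nat) \<Rightarrow> nat \<Rightarrow> nat" where
  "over_count f m = (\<Sum>y | snd y \<and> fst y < Suc m * \<eta>. f y)"

lemma finite_part_bound: "(\<And>y. P y \<Longrightarrow> fst y \<le> N) \<Longrightarrow> finite {y :: part. P y}"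
  by (rule finite_subset[of _ "{..N} \<times> UNIV"]) auto

lemma div_lt_iff: "n div \<eta> < m \<longleftrightarrow> n < m * \<eta>"
  using eta by (simp add: div_less_iff_less_mult)

lemma le_div_iff: "m \<le> n div \<eta> \<longleftrightarrow> m * \<eta> \<le> n"
  using div_lt_iff[of n m] by auto

lemma finite_block: "finite {y :: part. P y \<and> fst y div \<eta> = m}"
proof (rule finite_part_bound)
  fix y :: part assume "P y \<and> fst y div \<eta> = m"
  then show "fst y \<le> Suc m * \<eta>" using div_lt_iff[of "fst y" "Suc m"] by auto
qed

lemma finite_part_less: "finite {y :: part. P y \<and> fst y < N}"
  by (rule finite_part_bound[of _ N]) auto

lemma over_count_0:
  assumes "admissible f"
  shows "over_count f 0 = nonmult_block f 0"
  unfolding over_count_def nonmult_block_def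
proof (rule sum.mono_neutral_right)
  show "finite {y :: part. snd y \<and> fst y < Suc 0 * \<eta>}" by (rule finite_part_less)
  show "{y. snd y \<and> \<not> \<eta> dvd fst y \<and> fst y div \<eta> = 0} \<subseteq> {y :: part. snd y \<and> fst y < Suc 0 * \<eta>}"
    using eta by (auto simp: div_eq_0_iff)
  show "\<forall>y\<in>{y :: part. snd y \<and> fst y < Suc 0 * \<eta>} - {y. snd y \<and> \<not> \<eta> dvd fst y \<and> fst y div \<eta> = 0}. f y = 0"
    using assms by (auto simp: admissible_def dest: nat_dvd_not_less)
qed

lemma over_count_Suc:
  "over_count f (Suc m) = over_count f m + f (Suc m * \<eta>, True) + nonmult_block f (Suc m)"
proof -
  let ?M = "{y :: part. snd y \<and> \<not> \<eta> dvd fst y \<and> fst y div \<eta> = Suc m}"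
  have split: "{y :: part. snd y \<and> fst y < Suc (Suc m) * \<eta>}
      = {y. snd y \<and> fst y < Suc m * \<eta>} \<union> insert (Suc m * \<eta>, True) ?M"
    (is "?L = ?R")
  proof (intro set_eqI iffI)
    fix y :: part assume y: "y \<in> ?L"
    obtain n v where [simp]: "y = (n, v)" by (cases y)
    show "y \<in> ?R"
    proof (cases "n < Suc m * \<eta>")
      case False
      then have d: "n div \<eta> = Suc m"
      proof -
        have "n < Suc (Suc m) * \<eta>" using y by (simp del: mult_Suc)
        then have "n div \<eta> < Suc (Suc m)" by (simp only: div_lt_iff)
        moreover have "\<not> n div \<eta> < Suc m" using False by (simp only: div_lt_iff) simp
        ultimately show ?thesis by simp
      qed
      show ?thesis
      proof (cases "\<eta> dvd n")
        case True
        then have "n = Suc m * \<eta>" using d by (metis dvd_div_mult_self)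
        then show ?thesis using y by (simp del: mult_Suc)
      qed (use y d in \<open>simp del: mult_Suc\<close>)
    qed (use y in \<open>simp del: mult_Suc\<close>)
  next
    fix y :: part assume y: "y \<in> ?R"
    then show "y \<in> ?L"
    proof (elim UnE insertE)
      assume "y \<in> ?M"
      then show ?thesis using div_lt_iff[of "fst y" "Suc (Suc m)"] by (simp del: mult_Suc)
    qed (use eta in auto)
  qed
  have fin: "finite ?M"
    using finite_block[of "\<lambda>y. snd y \<and> \<not> \<eta> dvd fst y" "Suc m"] by simp
  have disj: "{y :: part. snd y \<and> fst y < Suc m * \<eta>} \<inter> insert (Suc m * \<eta>, True) ?M = {}"
  proof -
    have "fst y div \<eta> < Suc m" if "fst y < Suc m * \<eta>" for y :: part
      using that by (simp only: div_lt_iff)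
    then show ?thesis by (fastforce simp del: mult_Suc)
  qed
  have "sum f (insert (Suc m * \<eta>, True) ?M) = f (Suc m * \<eta>, True) + sum f ?M"
    using fin by (subst sum.insert) (simp_all del: mult_Suc)
  then show ?thesis
    unfolding over_count_def nonmult_block_def split
    using sum.union_disjoint[OF finite_part_less _ disj, of f] fin by (simp del: mult_Suc)
qed

section \<open>Window sums\<close>

lemma sum_window_split:
  "(\<Sum>y\<in>window \<eta> x. f y) = (\<Sum>y | y \<in> window \<eta> x \<and> \<eta> dvd fst y. f y) + nonmult_window f x"
proof -
  let ?M = "{y. y \<in> window \<eta> x \<and> \<eta> dvd fst y}" and ?N = "{y. y \<in> window \<eta> x \<and> \<not> \<eta> dvd fst y}"
  have "sum f (window \<eta> x) = sum f (?M \<union> ?N)" by (rule sum.cong) auto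
  also have "\<dots> = sum f ?M + sum f ?N"
    by (rule sum.union_disjoint) (auto intro: finite_subset[OF _ finite_window])
  finally show ?thesis unfolding nonmult_window_def .
qed

text \<open>The window of an overlined part of size n covers the sizes p with n - \<eta> < p \<le>
  n, among them a single multiple of \<eta>, in both kinds.\<close>

lemma window_sum_over:
  assumes "n div \<eta> = m"
  shows "(\<Sum>y\<in>window \<eta> (n, True). f y) = mult_count f m + nonmult_window f (n, True)"
proof -
  have n: "m * \<eta> \<le> n" "n < Suc m * \<eta>"
    using assms le_div_iff[of m n] div_lt_iff[of n "Suc m"] by auto
  have "{y. y \<in> window \<eta> (n, True) \<and> \<eta> dvd fst y} = {(m * \<eta>, False), (m * \<eta>, True)}" (is "?L = ?R")
  proof (intro set_eqI iffI)
    fix y assume y: "y \<in> ?L"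
    then obtain q v where yq: "y = (q * \<eta>, v)" by (cases y) (auto simp: dvd_def mult.commute)
    have "q * \<eta> \<le> n" "n < Suc q * \<eta>"
      using y unfolding yq window_def part_plus_def by auto
    then have "n div \<eta> = q"
      using le_div_iff[of q n] div_lt_iff[of n "Suc q"] by simp
    then show "y \<in> ?R" using assms yq by auto
  next
    fix y assume "y \<in> ?R"
    then show "y \<in> ?L" using n by (auto simp: window_def part_plus_def)
  qed
  then show ?thesis unfolding sum_window_split by (simp add: mult_count_def)
qed

lemma nonmult_window_eq_block:
  assumes "admissible f"
  shows "nonmult_window f (Suc m * \<eta>, False) = nonmult_block f m"
  unfolding nonmult_window_def nonmult_block_def
proof (rule sum.mono_neutral_right)
  show "finite {y. y \<in> window \<eta> (Suc m * \<eta>, False) \<and> \<not> \<eta> dvd fst y}"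
    by (rule finite_subset[OF _ finite_window]) auto
  show "{y. snd y \<and> \<not> \<eta> dvd fst y \<and> fst y div \<eta> = m}
      \<subseteq> {y. y \<in> window \<eta> (Suc m * \<eta>, False) \<and> \<not> \<eta> dvd fst y}"
  proof
    fix y :: part assume y: "y \<in> {y. snd y \<and> \<not> \<eta> dvd fst y \<and> fst y div \<eta> = m}"
    obtain n v where yn: "y = (n, v)" by (cases y)
    have "m * \<eta> \<le> n" "n < Suc m * \<eta>"
      using y yn le_div_iff[of m n] div_lt_iff[of n "Suc m"] by auto
    then show "y \<in> {y. y \<in> window \<eta> (Suc m * \<eta>, False) \<and> \<not> \<eta> dvd fst y}"
      using y yn by (auto simp: window_def part_plus_def)
  qed
  show "\<forall>y\<in>{y. y \<in> window \<eta> (Suc m * \<eta>, False) \<and> \<not> \<eta> dvd fst y} -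
      {y. snd y \<and> \<not> \<eta> dvd fst y \<and> fst y div \<eta> = m}. f y = 0"
  proof
    fix y assume y: "y \<in> {y. y \<in> window \<eta> (Suc m * \<eta>, False) \<and> \<not> \<eta> dvd fst y} -
      {y. snd y \<and> \<not> \<eta> dvd fst y \<and> fst y div \<eta> = m}"
    obtain n v where yn: "y = (n, v)" by (cases y)
    have nd: "\<not> \<eta> dvd n" using y yn by simp
    have "n \<noteq> Suc m * \<eta>" using nd by (metis dvd_triv_right)
    then have "m * \<eta> \<le> n" "n < Suc m * \<eta>"
      using y unfolding yn window_def part_plus_def by auto
    then have "n div \<eta> = m" using le_div_iff[of m n] div_lt_iff[of n "Suc m"] by auto
    then have "v = False" using y yn by auto
    then show "f y = 0" using assms nd yn by (auto simp: admissible_def)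
  qed
qed

text \<open>This window covers one size more and so has a multiple of \<eta> at either end: the
  upper one only non-overlined, the lower one in both kinds.\<close>

lemma window_sum_mult:
  assumes "admissible f"
  shows "(\<Sum>y\<in>window \<eta> (Suc m * \<eta>, False). f y)
    = f (Suc m * \<eta>, False) + mult_count f m + nonmult_block f m"
proof -
  have "{y. y \<in> window \<eta> (Suc m * \<eta>, False) \<and> \<eta> dvd fst y}
    = {(Suc m * \<eta>, False), (m * \<eta>, False), (m * \<eta>, True)}" (is "?L = ?R")
  proof (intro set_eqI iffI)
    fix y assume y: "y \<in> ?L"
    then obtain q v where yq: "y = (q * \<eta>, v)" by (cases y) (auto simp: dvd_def mult.commute)
    have "(q * \<eta>, v) \<le> (Suc m * \<eta>, False)" "(Suc m * \<eta>, False) \<le> (Suc q * \<eta>, v)"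
      using y unfolding yq window_def part_plus_def by (auto simp: add.commute)
    then have "q * \<eta> < Suc m * \<eta> \<or> q * \<eta> = Suc m * \<eta> \<and> \<not> v" "Suc m * \<eta> \<le> Suc q * \<eta>"
      by (auto simp: less_eq_prod_def le_less)
    then have "q < Suc m \<or> q = Suc m \<and> \<not> v" "m \<le> q"
      using eta by (auto simp del: mult_Suc)
    then have "q = m \<or> q = Suc m \<and> \<not> v" by auto
    then show "y \<in> ?R" unfolding yq by (cases v) auto
  next
    fix y assume "y \<in> ?R"
    then show "y \<in> ?L" using eta by (auto simp: window_def part_plus_def)
  qed
  then show ?thesis
    using eta unfolding sum_window_split nonmult_window_eq_block[OF assms]
    by (simp add: mult_count_def)
qed

text \<open>Overlining the end changes the window only at multiples of \<eta>. Hence the bounds for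
  windows ending at overlined parts also bound
  \<open>mult_count f (Suc m) + nonmult_block f m\<close>.\<close>

lemma nonmult_window_top:
  assumes "admissible f"
  shows "nonmult_window f (Suc m * \<eta>, True) = nonmult_block f m"
proof -
  have "nonmult_window f (Suc m * \<eta>, True) = nonmult_window f (Suc m * \<eta>, False)"
    unfolding nonmult_window_def
  proof (rule sum.cong[OF _ refl])
    have "(n, v) \<in> window \<eta> (Suc m * \<eta>, True) \<longleftrightarrow> (n, v) \<in> window \<eta> (Suc m * \<eta>, False)"
      if "\<not> \<eta> dvd n" for n v
    proof -
      have "n \<noteq> Suc m * \<eta>" "n + \<eta> \<noteq> Suc m * \<eta>"
        using that by (metis dvd_triv_right, metis dvd_add_left_iff dvd_refl dvd_triv_right)
      then show ?thesis by (auto simp: window_def part_plus_def)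
    qed
    then show "{y. y \<in> window \<eta> (Suc m * \<eta>, True) \<and> \<not> \<eta> dvd fst y}
      = {y. y \<in> window \<eta> (Suc m * \<eta>, False) \<and> \<not> \<eta> dvd fst y}" by auto
  qed
  then show ?thesis using nonmult_window_eq_block[OF assms] by simp
qed

text \<open>Non-multiples are overlined, hence occur at most once, and two sizes in this window
  differ by less than \<eta>, so each residue in \<open>A\<close> is met at most once. Here
  \<lambda> < k - 1 enters.\<close>

lemma nonmult_window_le:
  assumes "admissible f"
  shows "nonmult_window f (n, True) \<le> c"
proof -
  let ?S = "{y. y \<in> window \<eta> (n, True) \<and> \<not> \<eta> dvd fst y \<and> f y \<noteq> 0}"
  have fin: "finite ?S" by (rule finite_subset[OF _ finite_window]) auto
  have ov: "snd y" if "y \<in> ?S" for y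
    using that assms unfolding admissible_def by (cases y; cases "snd y") auto
  have "nonmult_window f (n, True) = sum f ?S"
    unfolding nonmult_window_def
    by (rule sum.mono_neutral_right) (auto intro: finite_subset[OF _ finite_window])
  also have "\<dots> \<le> (\<Sum>y\<in>?S. 1)"
  proof (rule sum_mono)
    fix y assume y: "y \<in> ?S"
    have "y = (fst y, True)" using ov[OF y] by (simp add: prod_eq_iff)
    then show "f y \<le> 1" using assms unfolding admissible_def by metis
  qed
  also have "\<dots> = card ?S" by simp
  also have "card ?S = card ((\<lambda>y. fst y mod \<eta>) ` ?S)"
  proof (rule card_image[symmetric], rule inj_onI)
    fix y z assume yz: "y \<in> ?S" "z \<in> ?S" "fst y mod \<eta> = fst z mod \<eta>"
    have *: "fst y \<le> n \<and> n < fst y + \<eta>" if "y \<in> ?S" for y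
      using that by (cases y) (auto simp: window_def part_plus_def)
    have no_less: False if "p < q" "p mod \<eta> = q mod \<eta>" "q < p + \<eta>" for p q :: nat
    proof -
      have "\<eta> dvd q - p" using that mod_eq_dvd_iff_nat[of p q \<eta>] by simp
      then have "\<eta> \<le> q - p" using that by (intro dvd_imp_le) auto
      then show False using that by simp
    qed
    have "fst y = fst z"
      using no_less[of "fst y" "fst z"] no_less[of "fst z" "fst y"] yz(3) *[OF yz(1)] *[OF yz(2)]
      by (metis linorder_neqE_nat order.strict_trans1)
    then show "y = z" using ov[OF yz(1)] ov[OF yz(2)] by (simp add: prod_eq_iff)
  qed
  also have "\<dots> \<le> card A"
  proof (rule card_mono)
    show "finite A" using A by (rule finite_subset) simp
    show "(\<lambda>y. fst y mod \<eta>) ` ?S \<subseteq> A"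
      using assms unfolding admissible_def by (auto simp: dvd_eq_mod_eq_0)
  qed
  finally show ?thesis using card_A by simp
qed

text \<open>\<open>over_count f m\<close> stands on the left to balance the overlined parts below
  the end block, which V counts but which add nothing to the surplus of the quotients over
  m.\<close>

lemma parity_sum:
  assumes f: "admissible f" and x: "fst x div \<eta> = Suc m" "snd x \<or> \<eta> dvd fst x"
  shows "(\<Sum>y\<in>window \<eta> x. f y * (fst y div \<eta>)) + over_count f m
    = m * (\<Sum>y\<in>window \<eta> x. f y) + f (Suc m * \<eta>, False) + (\<Sum>y | snd y \<and> y \<le> x. f y)"
proof -
  obtain n w where xn: "x = (n, w)" by (cases x)
  have n: "Suc m * \<eta> \<le> n" "n < Suc (Suc m) * \<eta>"
    using x xn le_div_iff[of "Suc m" n] div_lt_iff[of n "Suc (Suc m)"] by auto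
  let ?N = "{y. snd y \<and> Suc m * \<eta> \<le> fst y \<and> y \<le> x}"
  have finN: "finite ?N" by (rule finite_subset[OF _ finite_le_part[of x]]) auto
  have block: "fst y div \<eta> = m + (if Suc m * \<eta> \<le> fst y then 1 else 0)" if "y \<in> window \<eta> x" for y
  proof -
    obtain p v where yp: "y = (p, v)" by (cases y)
    have "p \<le> n" "n \<le> p + \<eta>" using that unfolding yp xn window_def part_plus_def by auto
    then have "m * \<eta> \<le> p" "p < Suc (Suc m) * \<eta>" using n by auto
    then have "m \<le> p div \<eta>" "p div \<eta> < Suc (Suc m)" by (simp_all only: le_div_iff div_lt_iff)
    then show ?thesis unfolding yp using le_div_iff[of "Suc m" p] by auto
  qed
  have "(\<Sum>y\<in>window \<eta> x. f y * (fst y div \<eta>))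
      = (\<Sum>y\<in>window \<eta> x. m * f y + (if Suc m * \<eta> \<le> fst y then f y else 0))"
    by (rule sum.cong) (auto simp: block)
  also have "\<dots> = m * (\<Sum>y\<in>window \<eta> x. f y)
      + (\<Sum>y | y \<in> window \<eta> x \<and> Suc m * \<eta> \<le> fst y. f y)"
    using finite_window[of \<eta> x]
    by (simp add: sum.distrib sum_distrib_left sum.inter_filter)
  \<comment> \<open>The only non-overlined parts in block m + 1 are the copies of (m + 1)\<eta>, the
    one multiple of \<eta> there.\<close>
  also have "(\<Sum>y | y \<in> window \<eta> x \<and> Suc m * \<eta> \<le> fst y. f y) = sum f (insert (Suc m * \<eta>, False) ?N)"
  proof (rule sum.mono_neutral_right)
    show "finite {y. y \<in> window \<eta> x \<and> Suc m * \<eta> \<le> fst y}"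
      by (rule finite_subset[OF _ finite_window]) auto
    show "insert (Suc m * \<eta>, False) ?N \<subseteq> {y. y \<in> window \<eta> x \<and> Suc m * \<eta> \<le> fst y}"
      using n eta unfolding xn by (auto simp: window_def part_plus_def)
    show "\<forall>y\<in>{y. y \<in> window \<eta> x \<and> Suc m * \<eta> \<le> fst y} - insert (Suc m * \<eta>, False) ?N. f y = 0"
    proof
      fix y assume y: "y \<in> {y. y \<in> window \<eta> x \<and> Suc m * \<eta> \<le> fst y} - insert (Suc m * \<eta>, False) ?N"
      obtain p v where yp: "y = (p, v)" by (cases y)
      have yx: "y \<le> x" using y by (simp add: window_def)
      then have v: "\<not> v" using y yp by auto
      have "p < Suc (Suc m) * \<eta>" using yx n unfolding yp xn by auto
      moreover have "Suc m * \<eta> \<le> p" using y yp by simp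
      ultimately have "p div \<eta> = Suc m"
        using le_div_iff[of "Suc m" p] div_lt_iff[of p "Suc (Suc m)"] by auto
      moreover have "p \<noteq> Suc m * \<eta>" using y yp v by auto
      ultimately have "\<not> \<eta> dvd p" by (metis dvd_div_mult_self)
      then show "f y = 0" using f v yp by (auto simp: admissible_def)
    qed
  qed
  also have "\<dots> = f (Suc m * \<eta>, False) + sum f ?N" using finN by simp
  also have "sum f ?N + over_count f m = (\<Sum>y | snd y \<and> y \<le> x. f y)"
  proof -
    have "{y. snd y \<and> y \<le> x} = ?N \<union> {y. snd y \<and> fst y < Suc m * \<eta>}"
      using n unfolding xn by auto
    moreover have "?N \<inter> {y. snd y \<and> fst y < Suc m * \<eta>} = {}" by auto
    ultimately show ?thesis
      unfolding over_count_def using sum.union_disjoint[OF finN finite_part_less, of snd "Suc m * \<eta>" f] by simp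
  qed
  ultimately show ?thesis by simp
qed

section \<open>Splitting off a partition into distinct multiples\<close>

text \<open>The congruence of condition (5) for any full window ending in block \<open>m + 1\<close> amounts to
  \<open>parity_state f m + f (Suc m * \<eta>, False)\<close> being even, whatever the window.  The number
  \<open>r - 1\<close> enters as \<open>r + 1\<close>.\<close>

definition parity_state :: "(part \<Rightarrow> nat) \<Rightarrow> nat \<Rightarrow> nat" where
  "parity_state f m = r + 1 + m * (c + 1) + over_count f m"

text \<open>The number of parts by which a window ending in block \<open>m\<close> may exceed c. For
  m = 0 the truncated \<open>m - 1\<close> gives a meaningless value, harmless since an admissible
  \<open>f\<close> has no part of size 0.\<close>

definition slack :: "(part \<Rightarrow> nat) \<Rightarrow> nat \<Rightarrow> nat" where
  "slack f m = (if even (parity_state f (m - 1) + f (m * \<eta>, False)) then 1 else 0)"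

text \<open>Windows ending in block 0 are left out: without parts of size 0 they hold at most c
  parts, by \<open>nonmult_window_le\<close>.\<close>

definition upper_ok :: "(part \<Rightarrow> nat) \<Rightarrow> bool" where
  "upper_ok f \<longleftrightarrow> f (\<eta>, False) + nonmult_block f 0 + 1 \<le> r \<and>
     (\<forall>m n. n div \<eta> = Suc m \<longrightarrow>
        mult_count f (Suc m) + nonmult_window f (n, True) \<le> c + slack f (Suc m)) \<and>
     (\<forall>m. f (Suc m * \<eta>, False) + mult_count f m + nonmult_block f m \<le> c + slack f (Suc m))"

definition lower_ok :: "(part \<Rightarrow> nat) \<Rightarrow> bool" where
  "lower_ok h \<longleftrightarrow> h (\<eta>, False) + nonmult_block h 0 + 1 \<le> (if r = c + 2 then c + 1 else r) \<and>
     (\<forall>m n. n div \<eta> = Suc m \<longrightarrow> mult_count h (Suc m) + nonmult_window h (n, True) \<le> c) \<and>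
     (\<forall>m. h (Suc m * \<eta>, False) + mult_count h m + nonmult_block h m \<le> c)"

definition upper_set :: "(part \<Rightarrow> nat) set" where
  "upper_set = {f. admissible f \<and> upper_ok f}"

definition lower_set :: "(part \<Rightarrow> nat) set" where
  "lower_set = {h. admissible h \<and> (\<forall>n. \<eta> dvd n \<longrightarrow> h (n, True) = 0) \<and> lower_ok h}"

definition distinct_set :: "(nat \<Rightarrow> nat) set" where
  "distinct_set = {z. finite {n. z n \<noteq> 0} \<and> z 0 = 0 \<and> (\<forall>n. z n \<le> 1) \<and> (\<forall>n. z n \<noteq> 0 \<longrightarrow> \<eta> dvd n)}"

definition lower :: "(part \<Rightarrow> nat) \<Rightarrow> part \<Rightarrow> nat" where
  "lower f y = (if \<eta> dvd fst y
     then if snd y then 0 else mult_count f (fst y div \<eta>) - slack f (fst y div \<eta>)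
     else f y)"

text \<open>The \<open>min\<close> matches the truncated subtraction in \<open>lower\<close>, as
  \<open>min t s + (t - s) = t\<close> for all t and s.\<close>

definition excess :: "(part \<Rightarrow> nat) \<Rightarrow> nat \<Rightarrow> nat" where
  "excess f n = (if \<eta> dvd n then min (mult_count f (n div \<eta>)) (slack f (n div \<eta>)) else 0)"

text \<open>\<open>v\<close> stands for the number of overlined parts below (m + 1)\<eta> in the
  overpartition being rebuilt, so \<open>r + 1 + m * (c + 1) + v\<close> is its parity state. The
  choice of the bit is the one forced in \<open>remove_insert_step\<close>.\<close>

definition over_bit :: "(nat \<Rightarrow> nat) \<Rightarrow> (part \<Rightarrow> nat) \<Rightarrow> nat \<Rightarrow> nat \<Rightarrow> nat" where
  "over_bit z h m v =
     (if even (r + 1 + m * (c + 1) + v + h (Suc m * \<eta>, False)) \<and>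
         0 < z (Suc m * \<eta>) + h (Suc m * \<eta>, False) then 1 else 0)"

text \<open>\<open>insert_over z h m\<close> anticipates \<open>over_count (insert_parts z h) m\<close>.\<close>

primrec insert_over :: "(nat \<Rightarrow> nat) \<Rightarrow> (part \<Rightarrow> nat) \<Rightarrow> nat \<Rightarrow> nat" where
  "insert_over z h 0 = nonmult_block h 0"
| "insert_over z h (Suc m) =
     insert_over z h m + over_bit z h m (insert_over z h m) + nonmult_block h (Suc m)"

definition insert_bit :: "(nat \<Rightarrow> nat) \<Rightarrow> (part \<Rightarrow> nat) \<Rightarrow> nat \<Rightarrow> nat" where
  "insert_bit z h m = (case m of 0 \<Rightarrow> 0 | Suc j \<Rightarrow> over_bit z h j (insert_over z h j))"

definition insert_parts :: "(nat \<Rightarrow> nat) \<Rightarrow> (part \<Rightarrow> nat) \<Rightarrow> part \<Rightarrow> nat" where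
  "insert_parts z h y = (if \<eta> dvd fst y
     then if snd y then insert_bit z h (fst y div \<eta>)
       else z (fst y) + h (fst y, False) - insert_bit z h (fst y div \<eta>)
     else h y)"

section \<open>Equivalence of the two systems of bounds\<close>

lemma nonmult_window_cong:
  "(\<And>y. \<not> \<eta> dvd fst y \<Longrightarrow> f y = g y) \<Longrightarrow> nonmult_window f x = nonmult_window g x"
  unfolding nonmult_window_def by (rule sum.cong) auto

lemma nonmult_block_cong:
  "(\<And>y. \<not> \<eta> dvd fst y \<Longrightarrow> f y = g y) \<Longrightarrow> nonmult_block f m = nonmult_block g m"
  unfolding nonmult_block_def by (rule sum.cong) auto

lemma lower_nonmult [simp]:
  "nonmult_window (lower f) x = nonmult_window f x" "nonmult_block (lower f) m = nonmult_block f m"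
  by (rule nonmult_window_cong nonmult_block_cong; simp add: lower_def)+

lemma insert_parts_nonmult [simp]:
  "nonmult_block (insert_parts z h) m = nonmult_block h m"
  by (rule nonmult_block_cong) (simp add: insert_parts_def)

lemma mult_count_0: "admissible f \<Longrightarrow> mult_count f 0 = 0"
  by (simp add: admissible_def mult_count_def)

lemma slack_le_1: "slack f m \<le> 1"
  by (simp add: slack_def)

lemma over_le_1: "admissible f \<Longrightarrow> f (n, True) \<le> 1"
  by (simp add: admissible_def)

lemma lower_mult:
  "lower f (m * \<eta>, v) = (if v then 0 else mult_count f m - slack f m)"
  using eta by (simp add: lower_def)

lemma mult_count_lower: "mult_count (lower f) m = mult_count f m - slack f m"
  by (simp add: mult_count_def lower_mult)

lemma slack_Suc:
  "slack f (Suc m) = (if even (parity_state f m + f (Suc m * \<eta>, False)) then 1 else 0)"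
  by (simp add: slack_def)

text \<open>The new state contains the overlined copies of the multiple and
  \<open>mult_count\<close> contains all copies, so modulo 2 only the non-overlined ones remain next
  to the old state, and that is what \<open>slack\<close> tests. This is the parity hypothesis of
  \<open>window_bound_step\<close>.\<close>

lemma parity_state_step:
  "even (parity_state f (Suc m) + c + slack f (Suc m) + mult_count f (Suc m)
     + nonmult_block f (Suc m))"
proof -
  have "parity_state f (Suc m) = parity_state f m + c + 1 + f (Suc m * \<eta>, True) + nonmult_block f (Suc m)"
    by (simp only: parity_state_def over_count_Suc) simp
  then show ?thesis
    by (cases "even (parity_state f m + f (Suc m * \<eta>, False))")
      (simp_all only: slack_Suc mult_count_def if_True if_False, presburger+)
qed

lemma nonmult_block_le: "admissible f \<Longrightarrow> nonmult_block f m \<le> c"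
  using nonmult_window_le nonmult_window_top by metis

lemma div_Suc_mult: "(Suc m * \<eta>) div \<eta> = Suc m"
  using eta by simp

lemma upper_ok_iff_lower_ok:
  assumes f: "admissible f"
  shows "upper_ok f \<longleftrightarrow> lower_ok (lower f)"
proof -
  let ?U1 = "\<forall>m n. n div \<eta> = Suc m \<longrightarrow>
        mult_count f (Suc m) + nonmult_window f (n, True) \<le> c + slack f (Suc m)"
  let ?L1 = "\<forall>m n. n div \<eta> = Suc m \<longrightarrow>
        mult_count (lower f) (Suc m) + nonmult_window (lower f) (n, True) \<le> c"
  have 1: "?U1 \<longleftrightarrow> ?L1"
  proof -
    \<comment> \<open>The bound on \<open>w\<close> covers t < s, where the subtraction
      truncates.\<close>
    have "t + w \<le> c + s \<longleftrightarrow> (t - s) + w \<le> c" if "w \<le> c" for t w s :: nat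
      using that by auto
    then show ?thesis using nonmult_window_le[OF f] by (simp add: mult_count_lower)
  qed
  \<comment> \<open>The window of the overlined (m + 1)\<eta> bounds the number of all its copies.
    The parity fact needs a test at m itself, so m = 0 is treated separately.\<close>
  have 2: "(f (Suc m * \<eta>, False) + mult_count f m + nonmult_block f m \<le> c + slack f (Suc m)) \<longleftrightarrow>
      (lower f (Suc m * \<eta>, False) + mult_count (lower f) m + nonmult_block (lower f) m \<le> c)"
    if u: ?U1 and m: "m = Suc j" for m j
  proof -
    have "mult_count f (Suc m) + nonmult_block f m \<le> c + slack f (Suc m)"
      using u nonmult_window_top[OF f, of m] div_Suc_mult[of m] by metis
    then have "f (Suc m * \<eta>, False) + f (Suc m * \<eta>, True) + nonmult_block f m \<le> c + slack f (Suc m)"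
      by (simp only: mult_count_def)
    from window_bound_step[OF over_le_1[OF f] slack_Suc slack_le_1 parity_state_step[of f j, folded m]
        this nonmult_block_le[OF f]]
    show ?thesis
      unfolding mult_count_lower lower_mult lower_nonmult if_False mult_count_def[of f "Suc m"] .
  qed
  have 3: "f (\<eta>, False) + nonmult_block f 0 + 1 \<le> r \<longleftrightarrow>
      lower f (\<eta>, False) + nonmult_block (lower f) 0 + 1 \<le> (if r = c + 2 then c + 1 else r)"
    if u: ?U1
  proof -
    have "mult_count f (Suc 0) + nonmult_block f 0 \<le> c + slack f (Suc 0)"
      using u nonmult_window_top[OF f, of 0] div_Suc_mult[of 0] by metis
    then have *: "f (Suc 0 * \<eta>, False) + f (Suc 0 * \<eta>, True) + nonmult_block f 0 \<le> c + slack f (Suc 0)"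
      by (simp only: mult_count_def)
    have "parity_state f 0 = r + 1 + nonmult_block f 0"
      by (simp add: parity_state_def over_count_0[OF f])
    from first_bound_step[OF over_le_1[OF f] slack_Suc this * nonmult_block_le[OF f] r(2)]
    show ?thesis
      using lower_mult[of f "Suc 0" False] by (simp add: mult_count_def)
  qed
  \<comment> \<open>For m = 0 this is the window of condition (4). Only the value c + 1 is critical;
    it forces r = c + 2, and then the test succeeds.\<close>
  have 4: "f (Suc 0 * \<eta>, False) + mult_count f 0 + nonmult_block f 0 \<le> c + slack f (Suc 0)"
    if "f (\<eta>, False) + nonmult_block f 0 + 1 \<le> r"
  proof (cases "f (\<eta>, False) + nonmult_block f 0 \<le> c")
    case False
    then have "f (\<eta>, False) + nonmult_block f 0 = c + 1" "r = c + 2" using that r by auto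
    moreover have "parity_state f 0 = r + 1 + nonmult_block f 0"
      by (simp add: parity_state_def over_count_0[OF f])
    ultimately have "parity_state f 0 + f (Suc 0 * \<eta>, False) = 2 * (c + 2)" by simp
    then have "even (parity_state f 0 + f (Suc 0 * \<eta>, False))" by simp
    then have "slack f (Suc 0) = 1" by (simp add: slack_Suc)
    then show ?thesis
      using that r(2) by (simp add: mult_count_0[OF f])
  qed (simp add: mult_count_0[OF f])
  have 5: "lower f (Suc 0 * \<eta>, False) + mult_count (lower f) 0 + nonmult_block (lower f) 0 \<le> c"
    if "lower f (\<eta>, False) + nonmult_block (lower f) 0 + 1 \<le> (if r = c + 2 then c + 1 else r)"
    using that r(2) by (simp add: mult_count_lower mult_count_0[OF f] split: if_splits)
  have all_nat: "(\<forall>m. P m) \<longleftrightarrow> P 0 \<and> (\<forall>m. P (Suc m))" for P :: "nat \<Rightarrow> bool"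
    by (metis not0_implies_Suc)
  show ?thesis
    unfolding upper_ok_def lower_ok_def
    using 1 2[OF _ refl] 3 4 5
    unfolding all_nat[of "\<lambda>m. f (Suc m * \<eta>, False) + mult_count f m + nonmult_block f m \<le> c + slack f (Suc m)"]
      all_nat[of "\<lambda>m. lower f (Suc m * \<eta>, False) + mult_count (lower f) m + nonmult_block (lower f) m \<le> c"]
    by blast
qed

section \<open>The components \<zeta> and \<mu> of an overpartition\<close>

lemma excess_plus_lower:
  "excess f (m * \<eta>) + lower f (m * \<eta>, False) = mult_count f m"
  using eta by (simp add: excess_def lower_mult)

lemma finite_part_support:
  assumes "finite {n. P n}" "\<And>y. Q y \<Longrightarrow> P (fst y)"
  shows "finite {y :: part. Q y}"
  by (rule finite_subset[of _ "{n. P n} \<times> UNIV"]) (use assms in auto)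

lemma dvdE_mult:
  assumes "\<eta> dvd n" obtains m where "n = m * \<eta>"
  using assms by (auto simp: dvd_def mult.commute)

lemma finite_sizes:
  assumes "admissible f" shows "finite {n. \<exists>v. f (n, v) \<noteq> 0}"
proof -
  have "{n. \<exists>v. f (n, v) \<noteq> 0} = fst ` {y. f y \<noteq> 0}" by force
  then show ?thesis using assms by (simp add: admissible_def)
qed

lemma lower_nonzero:
  assumes "lower f (n, v) \<noteq> 0" shows "\<exists>w. f (n, w) \<noteq> 0"
proof (cases "\<eta> dvd n")
  case True
  then obtain m where "n = m * \<eta>" by (rule dvdE_mult)
  then have "mult_count f m \<noteq> 0" using assms by (auto simp: lower_mult split: if_splits)
  then have "f (n, False) \<noteq> 0 \<or> f (n, True) \<noteq> 0" by (auto simp: mult_count_def \<open>n = m * \<eta>\<close>)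
  then show ?thesis by blast
qed (use assms in \<open>auto simp: lower_def\<close>)

lemma admissible_lower:
  assumes "admissible f" shows "admissible (lower f)"
  unfolding admissible_def
proof (intro conjI allI impI)
  show "finite {y. lower f y \<noteq> 0}"
    by (rule finite_part_support[OF finite_sizes[OF assms]]) (metis lower_nonzero prod.collapse)
  show "lower f (0, v) = 0" for v
    using lower_nonzero[of f 0 v] assms by (auto simp: admissible_def)
  show "lower f (n, True) \<le> 1" for n
    using assms by (simp add: lower_def admissible_def)
  show "n mod \<eta> \<in> insert 0 A" if "lower f (n, v) \<noteq> 0" for n v
    using lower_nonzero[OF that] assms by (auto simp: admissible_def)
  show "\<eta> dvd n" if "lower f (n, False) \<noteq> 0" for n
    using that assms by (auto simp: lower_def admissible_def split: if_splits)
qed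

lemma lower_in_lower_set:
  assumes "f \<in> upper_set" shows "lower f \<in> lower_set"
  using assms upper_ok_iff_lower_ok[of f] admissible_lower[of f]
  by (auto simp: upper_set_def lower_set_def lower_def)

lemma excess_in_distinct_set:
  assumes "admissible f" shows "excess f \<in> distinct_set"
  unfolding distinct_set_def
proof (intro CollectI conjI allI impI)
  have nz: "\<exists>v. f (n, v) \<noteq> 0" if "excess f n \<noteq> 0" for n
  proof -
    have "\<eta> dvd n" using that by (auto simp: excess_def split: if_splits)
    then obtain m where "n = m * \<eta>" by (rule dvdE_mult)
    then show ?thesis using that eta by (auto simp: excess_def mult_count_def split: if_splits)
  qed
  show "finite {n. excess f n \<noteq> 0}"
    by (rule finite_subset[OF _ finite_sizes[OF assms]]) (use nz in auto)
  show "excess f 0 = 0" using nz[of 0] assms by (auto simp: admissible_def)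
  show "excess f n \<le> 1" for n using slack_le_1[of f "n div \<eta>"] by (auto simp: excess_def)
  show "\<eta> dvd n" if "excess f n \<noteq> 0" for n using that by (auto simp: excess_def split: if_splits)
qed

section \<open>Putting the distinct multiples back\<close>

lemma insert_bit_le:
  "insert_bit z h m \<le> z (m * \<eta>) + h (m * \<eta>, False)" "insert_bit z h m \<le> 1"
  unfolding insert_bit_def over_bit_def by (auto split: nat.splits)

lemma insert_parts_mult:
  "insert_parts z h (m * \<eta>, v) =
     (if v then insert_bit z h m else z (m * \<eta>) + h (m * \<eta>, False) - insert_bit z h m)"
  using eta by (simp add: insert_parts_def)

lemma mult_count_insert_parts:
  "mult_count (insert_parts z h) m = z (m * \<eta>) + h (m * \<eta>, False)"
  using insert_bit_le[of z h m] by (simp add: mult_count_def insert_parts_mult)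

lemma admissible_insert_parts:
  assumes h: "h \<in> lower_set" and z: "z \<in> distinct_set"
  shows "admissible (insert_parts z h)"
proof -
  have adm: "admissible h" using h by (simp add: lower_set_def)
  have nz: "z n \<noteq> 0 \<or> (\<exists>w. h (n, w) \<noteq> 0)" if "insert_parts z h (n, v) \<noteq> 0" for n v
  proof (cases "\<eta> dvd n")
    case True
    then obtain m where n: "n = m * \<eta>" by (rule dvdE_mult)
    show ?thesis
      using that insert_bit_le(1)[of z h m] unfolding n insert_parts_mult
      by (auto split: if_splits)
  qed (use that in \<open>auto simp: insert_parts_def\<close>)
  show ?thesis
    unfolding admissible_def
  proof (intro conjI allI impI)
    have "finite ({n. z n \<noteq> 0} \<union> {n. \<exists>v. h (n, v) \<noteq> 0})"
      using z finite_sizes[OF adm] by (simp add: distinct_set_def)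
    then have "finite {n. z n \<noteq> 0 \<or> (\<exists>v. h (n, v) \<noteq> 0)}" by (simp add: Collect_disj_eq)
    then show "finite {y. insert_parts z h y \<noteq> 0}"
      by (rule finite_part_support) (metis nz prod.collapse)
    show "insert_parts z h (0, v) = 0" for v
      using nz[of 0 v] z adm by (auto simp: admissible_def distinct_set_def)
    show "insert_parts z h (n, True) \<le> 1" for n
      using insert_bit_le(2) over_le_1[OF adm] by (simp add: insert_parts_def)
    show "n mod \<eta> \<in> insert 0 A" if "insert_parts z h (n, v) \<noteq> 0" for n v
      using nz[OF that] z adm by (auto simp: admissible_def distinct_set_def)
    show "\<eta> dvd n" if "insert_parts z h (n, False) \<noteq> 0" for n
      using that adm by (auto simp: insert_parts_def admissible_def split: if_splits)
  qed
qed

lemma over_count_insert_parts: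
  assumes "h \<in> lower_set" "z \<in> distinct_set"
  shows "over_count (insert_parts z h) m = insert_over z h m"
proof (induction m)
  case 0
  show ?case using over_count_0[OF admissible_insert_parts[OF assms]] by simp
next
  case (Suc m)
  have "insert_parts z h (Suc m * \<eta>, True) = over_bit z h m (insert_over z h m)"
    unfolding insert_parts_mult by (simp add: insert_bit_def)
  then show ?case unfolding over_count_Suc using Suc by simp
qed

lemma lower_insert_parts:
  assumes h: "h \<in> lower_set" and z: "z \<in> distinct_set"
  shows "lower (insert_parts z h) = h"
proof
  fix y :: part
  obtain n v where y: "y = (n, v)" by (cases y)
  show "lower (insert_parts z h) y = h y"
  proof (cases "\<eta> dvd n")
    case True
    then obtain m where n: "n = m * \<eta>" by (rule dvdE_mult)
    show ?thesis
    proof (cases v)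
      case True
      then show ?thesis using h eta unfolding y n lower_mult by (simp add: lower_set_def)
    next
      case False
      have "mult_count (insert_parts z h) m - slack (insert_parts z h) m = h (m * \<eta>, False)"
      proof (cases m)
        case 0
        then show ?thesis
          using mult_count_0[OF admissible_insert_parts[OF h z]] h
          by (simp add: lower_set_def admissible_def)
      next
        case (Suc j)
        let ?s = "r + 1 + j * (c + 1) + insert_over z h j"
        let ?b = "over_bit z h j (insert_over z h j)"
        \<comment> \<open>The test is evaluated with the same state that chose the bit, so
          subtracting the slack takes away exactly \<open>z (Suc j * \<eta>)\<close> copies.\<close>
        have "slack (insert_parts z h) (Suc j) =
            (if even (?s + (z (Suc j * \<eta>) + h (Suc j * \<eta>, False) - ?b)) then 1 else 0)"
          unfolding slack_Suc parity_state_def over_count_insert_parts[OF h z] insert_parts_mult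
          by (simp only: insert_bit_def if_False nat.case)
        moreover have "z (Suc j * \<eta>) \<le> 1" using z by (simp add: distinct_set_def)
        ultimately show ?thesis
          unfolding mult_count_insert_parts Suc
          using remove_insert_step[OF _ over_bit_def[of z h j "insert_over z h j"]]
          by (simp only:)
      qed
      then show ?thesis using False unfolding y n lower_mult by simp
    qed
  qed (simp add: y lower_def insert_parts_def)
qed

text \<open>By cancellation: the copies of a multiple number \<open>z + h\<close> in all, and
  \<open>lower\<close> is known to return \<open>h\<close>.\<close>

lemma excess_insert_parts:
  assumes h: "h \<in> lower_set" and z: "z \<in> distinct_set"
  shows "excess (insert_parts z h) = z"
proof
  fix n
  show "excess (insert_parts z h) n = z n"
  proof (cases "\<eta> dvd n")
    case True
    then obtain m where n: "n = m * \<eta>" by (rule dvdE_mult)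
    show ?thesis
      using excess_plus_lower[of "insert_parts z h" m]
      unfolding n lower_insert_parts[OF h z] mult_count_insert_parts by simp
  next
    case False
    then show ?thesis using z by (auto simp: excess_def distinct_set_def)
  qed
qed

text \<open>No window has to be inspected again: \<open>upper_ok_iff_lower_ok\<close> applies to the
  rebuilt function, whose lower part is \<open>h\<close>.\<close>

lemma insert_parts_in_upper_set:
  assumes "h \<in> lower_set" "z \<in> distinct_set"
  shows "insert_parts z h \<in> upper_set"
  using admissible_insert_parts[OF assms] upper_ok_iff_lower_ok[of "insert_parts z h"]
    lower_insert_parts[OF assms] assms
  by (simp add: upper_set_def lower_set_def)

lemma insert_parts_excess_lower:
  assumes f: "admissible f"
  shows "insert_parts (excess f) (lower f) = f"
proof -
  have bit: "over_bit (excess f) (lower f) j (over_count f j) = f (Suc j * \<eta>, True)" for j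
    using insert_remove_step[OF over_le_1[OF f, of "Suc j * \<eta>"] slack_Suc[of f j]]
    unfolding over_bit_def excess_plus_lower unfolding lower_mult if_False
      mult_count_def parity_state_def[symmetric] .
  \<comment> \<open>\<open>bit\<close> presupposes the right number of overlined parts below, hence
    the induction upwards.\<close>
  have over: "insert_over (excess f) (lower f) j = over_count f j" for j
  proof (induction j)
    case 0
    show ?case by (simp add: over_count_0[OF f])
  next
    case (Suc j)
    then show ?case by (simp add: over_count_Suc bit)
  qed
  have ib: "insert_bit (excess f) (lower f) m = f (m * \<eta>, True)" for m
    using f bit by (cases m) (simp_all add: insert_bit_def over admissible_def)
  show ?thesis
  proof
    fix y :: part
    obtain n v where y: "y = (n, v)" by (cases y)
    show "insert_parts (excess f) (lower f) y = f y"
    proof (cases "\<eta> dvd n")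
      case True
      then obtain m where n: "n = m * \<eta>" by (rule dvdE_mult)
      show ?thesis
        unfolding y n insert_parts_mult excess_plus_lower ib by (simp add: mult_count_def)
    qed (simp add: y lower_def insert_parts_def)
  qed
qed

lemma bij_insert_parts:
  "bij_betw (\<lambda>(z, h). insert_parts z h) (distinct_set \<times> lower_set) upper_set"
proof (rule bij_betw_byWitness[where f' = "\<lambda>f. (excess f, lower f)"])
  show "\<forall>p\<in>distinct_set \<times> lower_set.
      (\<lambda>f. (excess f, lower f)) ((\<lambda>(z, h). insert_parts z h) p) = p"
    by (auto simp: excess_insert_parts lower_insert_parts)
  show "\<forall>f\<in>upper_set. (\<lambda>(z, h). insert_parts z h) ((\<lambda>f. (excess f, lower f)) f) = f"
    by (auto simp: insert_parts_excess_lower upper_set_def)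
  show "(\<lambda>(z, h). insert_parts z h) ` (distinct_set \<times> lower_set) \<subseteq> upper_set"
    by (auto intro: insert_parts_in_upper_set)
  show "(\<lambda>f. (excess f, lower f)) ` upper_set \<subseteq> distinct_set \<times> lower_set"
    using lower_in_lower_set excess_in_distinct_set by (auto simp: upper_set_def)
qed

lemma insert_parts_total:
  assumes h: "h \<in> lower_set" and z: "z \<in> distinct_set"
  shows "insert_parts z h (n, False) + insert_parts z h (n, True) = z n + h (n, False) + h (n, True)"
proof (cases "\<eta> dvd n")
  case True
  then obtain m where "n = m * \<eta>" by (rule dvdE_mult)
  then show ?thesis
    using mult_count_insert_parts[of z h m] h by (simp add: mult_count_def lower_set_def)
next
  case False
  then show ?thesis using z by (auto simp: insert_parts_def distinct_set_def)
qed

section \<open>Back to lists\<close>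

lemma D_set_eq: "D_set \<eta> = {\<zeta>. sorted_wrt (\<ge>) \<zeta> \<and> count_list \<zeta> \<in> distinct_set}"
proof -
  have "(\<forall>n\<in>set \<zeta>. n > 0 \<and> \<eta> dvd n) \<longleftrightarrow>
    count_list \<zeta> 0 = 0 \<and> (\<forall>n. count_list \<zeta> n \<noteq> 0 \<longrightarrow> \<eta> dvd n)" for \<zeta>
    by (auto simp: count_list_0_iff intro: gr0I)
  then show ?thesis
    unfolding D_set_def distinct_set_def distinct_sorted_iff
    using finite_count_list_support by blast
qed

lemma admissible_count_list_iff:
  assumes "sorted_wrt (\<ge>) \<pi>"
  shows "overpartition \<pi> \<and> (\<forall>x\<in>set \<pi>. \<exists>a\<in>insert 0 A. [part_size x = a] (mod \<eta>)) \<and>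
     (\<forall>x\<in>set \<pi>. \<not> overlined x \<longrightarrow> \<eta> dvd part_size x) \<longleftrightarrow> admissible (count_list \<pi>)"
proof -
  have res: "(\<exists>a\<in>insert 0 A. [n = a] (mod \<eta>)) \<longleftrightarrow> n mod \<eta> \<in> insert 0 A" for n
  proof -
    have "a mod \<eta> = a" if "a \<in> insert 0 A" for a using that A eta by auto
    then show ?thesis unfolding cong_def by auto
  qed
  have "(\<forall>x\<in>set \<pi>. part_size x > 0) \<longleftrightarrow> (\<forall>v. count_list \<pi> (0, v) = 0)"
    by (auto simp: count_list_0_iff intro: gr0I)
  then show ?thesis
    unfolding overpartition_def admissible_def res using assms
    by (auto simp: count_list_0_iff finite_count_list_support)
qed

text \<open>Block 0 contains no part divisible by \<eta>, so only the non-multiples of the window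
  count, at most \<open>c\<close> of them.\<close>

lemma window_sum_first_block:
  assumes f: "admissible f" and x: "snd x \<or> \<eta> dvd fst x" "fst x div \<eta> = 0"
  shows "(\<Sum>y\<in>window \<eta> x. f y) \<le> c"
proof -
  obtain n v where xn: "x = (n, v)" by (cases x)
  have n: "n div \<eta> = 0" using x xn by simp
  show ?thesis
  proof (cases v)
    case True
    then show ?thesis
      using nonmult_window_le[OF f, of n] window_sum_over[OF n] by (simp add: xn mult_count_0[OF f])
  next
    case False
    then have "n = 0" using x xn n by (auto dest: dvd_div_mult_self)
    then have "\<forall>y\<in>window \<eta> x. f y = 0"
      using f False xn by (auto simp: window_def admissible_def)
    then show ?thesis by simp
  qed
qed

text \<open>The bound is a function of the end block so that one statement serves both sides:
  \<open>c\<close> plus the slack, and the constant \<open>c\<close>. The assumption on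
  \<open>B 0\<close> disposes of windows ending in block 0.\<close>

lemma window_sum_bound_iff:
  assumes f: "admissible f" and B: "c \<le> B 0"
  shows "(\<forall>x. snd x \<or> \<eta> dvd fst x \<longrightarrow> (\<Sum>y\<in>window \<eta> x. f y) \<le> B (fst x div \<eta>)) \<longleftrightarrow>
    (\<forall>m n. n div \<eta> = Suc m \<longrightarrow> mult_count f (Suc m) + nonmult_window f (n, True) \<le> B (Suc m)) \<and>
    (\<forall>m. f (Suc m * \<eta>, False) + mult_count f m + nonmult_block f m \<le> B (Suc m))"
    (is "?L \<longleftrightarrow> ?R1 \<and> ?R2")
proof (intro iffI conjI allI impI)
  assume L: ?L
  show "mult_count f (Suc m) + nonmult_window f (n, True) \<le> B (Suc m)" if "n div \<eta> = Suc m" for m n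
    using L[rule_format, of "(n, True)"] that by (simp add: window_sum_over[OF that])
  show "f (Suc m * \<eta>, False) + mult_count f m + nonmult_block f m \<le> B (Suc m)" for m
    using L[rule_format, of "(Suc m * \<eta>, False)"] unfolding window_sum_mult[OF f]
    by (simp only: fst_conv snd_conv dvd_triv_right div_Suc_mult simp_thms)
next
  fix x :: part
  assume R: "?R1 \<and> ?R2" and x: "snd x \<or> \<eta> dvd fst x"
  obtain n v where xn: "x = (n, v)" by (cases x)
  show "(\<Sum>y\<in>window \<eta> x. f y) \<le> B (fst x div \<eta>)"
  proof (cases "n div \<eta>")
    case 0
    then show ?thesis using window_sum_first_block[OF f x] B xn by simp
  next
    case (Suc m)
    show ?thesis
    proof (cases v)
      case True
      then show ?thesis using R Suc window_sum_over[OF Suc, of f] by (simp add: xn)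
    next
      case False
      then obtain q where n: "n = q * \<eta>" using x xn by (auto elim: dvdE_mult)
      then have "q = Suc m" using Suc eta by simp
      then have "x = (Suc m * \<eta>, False)" using False xn n by simp
      then show ?thesis using R by (simp only: window_sum_mult[OF f] fst_conv div_Suc_mult)
    qed
  qed
qed

text \<open>The parts counted by condition (4) form the window of the non-overlined \<eta>.\<close>

lemma small_part_bound_iff:
  assumes f: "admissible (count_list \<pi>)"
  shows "int (length (filter (\<lambda>x. x \<le> (\<eta>, False)) \<pi>)) \<le> int R - 1 \<longleftrightarrow>
    count_list \<pi> (\<eta>, False) + nonmult_block (count_list \<pi>) 0 + 1 \<le> R"
proof -
  have "{y :: part. y \<le> (\<eta>, False)} = window \<eta> (Suc 0 * \<eta>, False)"
    by (auto simp: window_def part_plus_def)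
  then have "length (filter (\<lambda>x. x \<le> (\<eta>, False)) \<pi>)
      = (\<Sum>y\<in>window \<eta> (Suc 0 * \<eta>, False). count_list \<pi> y)"
    by (simp only: length_filter_eq_sum_count_list[OF finite_le_part])
  also have "\<dots> = count_list \<pi> (\<eta>, False) + nonmult_block (count_list \<pi>) 0"
    unfolding window_sum_mult[OF f] by (simp add: mult_count_0[OF f])
  finally show ?thesis by linarith
qed

text \<open>\<open>over_count\<close> enters once through \<open>parity_sum\<close> and once through
  \<open>parity_state\<close>, so it is doubled and vanishes modulo 2, where r - 1 and r + 1 agree
  as well.\<close>

lemma parity_cong_iff:
  assumes f: "admissible f" and x: "fst x div \<eta> = Suc m" "snd x \<or> \<eta> dvd fst x"
    and tight: "(\<Sum>y\<in>window \<eta> x. f y) = c + 1"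
  shows "[int (\<Sum>y\<in>window \<eta> x. f y * (fst y div \<eta>))
      = int r - 1 + int (\<Sum>y | snd y \<and> y \<le> x. f y)] (mod 2) \<longleftrightarrow> slack f (Suc m) = 1"
proof -
  let ?S = "\<Sum>y\<in>window \<eta> x. f y * (fst y div \<eta>)" and ?V = "\<Sum>y | snd y \<and> y \<le> x. f y"
  have "?S + over_count f m = m * (c + 1) + f (Suc m * \<eta>, False) + ?V"
    using parity_sum[OF f x] unfolding tight .
  then have "parity_state f m + f (Suc m * \<eta>, False) + ?V = r + 1 + ?S + 2 * over_count f m"
    unfolding parity_state_def by simp
  moreover have "even p \<longleftrightarrow> even (q + s + v)" if "p + v = q + s + 2 * w" for p q s v w :: nat
    using that by presburger
  ultimately have ps: "even (parity_state f m + f (Suc m * \<eta>, False)) \<longleftrightarrow> even (r + 1 + ?S + ?V)"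
    by blast
  have cong: "[int s = int r - 1 + int v] (mod 2) \<longleftrightarrow> even (r + 1 + s + v)" for s v
    unfolding cong_iff_dvd_diff by presburger
  show ?thesis unfolding cong slack_Suc ps by simp
qed

lemma admissible_count_list_parts:
  assumes "admissible (count_list \<pi>)"
  shows "\<forall>x\<in>set \<pi>. snd x \<or> \<eta> dvd fst x"
proof
  fix x assume "x \<in> set \<pi>"
  then have "count_list \<pi> (fst x, snd x) \<noteq> 0" by (simp add: count_list_0_iff)
  then show "snd x \<or> \<eta> dvd fst x" using assms by (cases "snd x") (auto simp: admissible_def)
qed

lemma B_bar_admissible:
  assumes "\<pi> \<in> B_bar j A \<eta> K R"
  shows "sorted_wrt (\<ge>) \<pi> \<and> admissible (count_list \<pi>)"
proof
  show srt: "sorted_wrt (\<ge>) \<pi>" using assms by (simp add: B_bar_def overpartition_def)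
  show "admissible (count_list \<pi>)"
    unfolding admissible_count_list_iff[OF srt, symmetric] using assms by (simp only: B_bar_def) blast
qed

lemma B_bar_eq:
  "B_bar 0 A \<eta> (c + 2) r = {\<pi>. sorted_wrt (\<ge>) \<pi> \<and> count_list \<pi> \<in> upper_set}"
proof (intro set_eqI)
  fix \<pi> :: "part list"
  let ?f = "count_list \<pi>" and ?Q = "\<lambda>x :: part. snd x \<or> \<eta> dvd fst x"
  let ?len = "\<lambda>x. length (filter (\<lambda>y. y \<in> window \<eta> x) \<pi>)"
  show "\<pi> \<in> B_bar 0 A \<eta> (c + 2) r \<longleftrightarrow> \<pi> \<in> {\<pi>. sorted_wrt (\<ge>) \<pi> \<and> count_list \<pi> \<in> upper_set}"
  proof (cases "sorted_wrt (\<ge>) \<pi> \<and> admissible ?f")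
    case False
    then show ?thesis
      using B_bar_admissible by (auto simp: upper_set_def)
  next
    case True
    then have srt: "sorted_wrt (\<ge>) \<pi>" and f: "admissible ?f" by auto
    note Q = admissible_count_list_parts[OF f]
    have len: "?len x = (\<Sum>y\<in>window \<eta> x. ?f y)" for x
      using length_filter_eq_sum_count_list[of "\<lambda>y. y \<in> window \<eta> x" \<pi>]
      by (simp add: finite_window)
    have S: "sum_list (map (\<lambda>y. part_size y div \<eta>) (filter (\<lambda>y. y \<in> window \<eta> x) \<pi>))
        = (\<Sum>y\<in>window \<eta> x. ?f y * (part_size y div \<eta>))" for x
      using sum_list_filter_eq_sum_count_list[of "\<lambda>y. y \<in> window \<eta> x" _ \<pi>]
      by (simp add: finite_window)
    have V: "V_bar \<pi> x = (\<Sum>y | snd y \<and> y \<le> x. ?f y)" for x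
      unfolding V_bar_def
      by (rule length_filter_eq_sum_count_list) (rule finite_subset[OF _ finite_le_part[of x]], auto)
    have "\<pi> \<in> B_bar 0 A \<eta> (c + 2) r \<longleftrightarrow>
        ?f (\<eta>, False) + nonmult_block ?f 0 + 1 \<le> r \<and> (\<forall>x. ?Q x \<longrightarrow> ?len x < c + 2) \<and>
        (\<forall>x. ?Q x \<longrightarrow> ?len x = c + 2 - 1 \<longrightarrow>
          [int (sum_list (map (\<lambda>y. part_size y div \<eta>) (filter (\<lambda>y. y \<in> window \<eta> x) \<pi>)))
           = int r - 1 + int (V_bar \<pi> x)] (mod 2 - int 0))"
      using f[folded admissible_count_list_iff[OF srt]]
        gap_condition_iff[OF srt _ Q, of "c + 2" \<eta>]
        parity_condition_iff[OF srt _ Q, of "c + 2" \<eta> "int r - 1" "2 - int 0"]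
        small_part_bound_iff[OF f, of r]
      unfolding B_bar_def mem_Collect_eq by auto
    also have "\<dots> \<longleftrightarrow> ?f (\<eta>, False) + nonmult_block ?f 0 + 1 \<le> r \<and>
        (\<forall>x. ?Q x \<longrightarrow> (\<Sum>y\<in>window \<eta> x. ?f y) \<le>
          (case fst x div \<eta> of 0 \<Rightarrow> c | Suc m \<Rightarrow> c + slack ?f (Suc m)))"
    proof -
      have "?len x < c + 2 \<and> (?len x = c + 2 - 1 \<longrightarrow>
          [int (sum_list (map (\<lambda>y. part_size y div \<eta>) (filter (\<lambda>y. y \<in> window \<eta> x) \<pi>)))
           = int r - 1 + int (V_bar \<pi> x)] (mod 2 - int 0)) \<longleftrightarrow>
         (\<Sum>y\<in>window \<eta> x. ?f y) \<le>
          (case fst x div \<eta> of 0 \<Rightarrow> c | Suc m \<Rightarrow> c + slack ?f (Suc m))" if x: "?Q x" for x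
      proof (cases "fst x div \<eta>")
        \<comment> \<open>No window ending in block 0 is full, so condition (5) says nothing
          there.\<close>
        case 0
        have "(\<Sum>y\<in>window \<eta> x. ?f y) \<le> c"
          by (rule window_sum_first_block[OF f x 0])
        then show ?thesis using 0 by (simp add: len)
      next
        case (Suc m)
        show ?thesis
          using parity_cong_iff[OF f Suc x] slack_le_1[of ?f "Suc m"]
          unfolding len S V Suc by (auto simp: le_Suc_eq)
      qed
      then show ?thesis by blast
    qed
    also have "\<dots> \<longleftrightarrow> upper_ok ?f"
      using window_sum_bound_iff[OF f, of "\<lambda>m. case m of 0 \<Rightarrow> c | Suc m \<Rightarrow> c + slack ?f (Suc m)"]
      unfolding upper_ok_def by simp
    finally show ?thesis using srt f by (simp add: upper_set_def)
  qed
qed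

lemma B_set_eq:
  "B_set 1 A \<eta> (c + 1) (if r = c + 2 then c + 1 else r)
    = {\<mu>. sorted_wrt (\<ge>) \<mu> \<and> count_list \<mu> \<in> lower_set}"
proof (intro set_eqI)
  fix \<pi> :: "part list"
  let ?f = "count_list \<pi>" and ?Q = "\<lambda>x :: part. snd x \<or> \<eta> dvd fst x"
  let ?len = "\<lambda>x. length (filter (\<lambda>y. y \<in> window \<eta> x) \<pi>)"
  let ?R = "if r = c + 2 then c + 1 else r"
  show "\<pi> \<in> B_set 1 A \<eta> (c + 1) ?R \<longleftrightarrow> \<pi> \<in> {\<pi>. sorted_wrt (\<ge>) \<pi> \<and> count_list \<pi> \<in> lower_set}"
  proof (cases "sorted_wrt (\<ge>) \<pi> \<and> admissible ?f")
    case False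
    then show ?thesis
      using B_bar_admissible by (auto simp: B_set_def lower_set_def)
  next
    case True
    then have srt: "sorted_wrt (\<ge>) \<pi>" and f: "admissible ?f" by auto
    note Q = admissible_count_list_parts[OF f]
    have len: "?len x = (\<Sum>y\<in>window \<eta> x. ?f y)" for x
      using length_filter_eq_sum_count_list[of "\<lambda>y. y \<in> window \<eta> x" \<pi>]
      by (simp add: finite_window)
    \<comment> \<open>For j = 1 the modulus is 1, so condition (5) is void, also for c = 0, where K
      = 1.\<close>
    have mod1: "[a = b] (mod 2 - int 1)" for a b :: int
      by (simp add: cong_def)
    have over: "(\<forall>x\<in>set \<pi>. overlined x \<longrightarrow> \<not> \<eta> dvd part_size x) \<longleftrightarrow>
        (\<forall>n. \<eta> dvd n \<longrightarrow> ?f (n, True) = 0)"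
      by (auto simp: count_list_0_iff)
    have "\<pi> \<in> B_bar 1 A \<eta> (c + 1) ?R \<longleftrightarrow>
        ?f (\<eta>, False) + nonmult_block ?f 0 + 1 \<le> ?R \<and> (\<forall>x. ?Q x \<longrightarrow> ?len x < c + 1)"
      using f[folded admissible_count_list_iff[OF srt]]
        gap_condition_iff[OF srt _ Q, of "c + 1" \<eta>]
        small_part_bound_iff[OF f, of ?R] mod1
      unfolding B_bar_def mem_Collect_eq by auto
    also have "\<dots> \<longleftrightarrow> lower_ok ?f"
      using window_sum_bound_iff[OF f, of "\<lambda>_. c"]
      unfolding lower_ok_def len by (simp add: less_Suc_eq_le)
    finally show ?thesis using srt f over by (auto simp: lower_set_def B_set_def)
  qed
qed

lemma ex_weight_preserving_bij:
  "\<exists>\<Phi>. bij_betw \<Phi>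
      (D_set \<eta> \<times> B_set 1 A \<eta> (c + 1) (if r = c + 2 then c + 1 else r)) (B_bar 0 A \<eta> (c + 2) r) \<and>
    (\<forall>\<zeta>\<in>D_set \<eta>. \<forall>\<mu>\<in>B_set 1 A \<eta> (c + 1) (if r = c + 2 then c + 1 else r).
      weight (\<Phi> (\<zeta>, \<mu>)) = sum_list \<zeta> + weight \<mu>)"
proof -
  let ?\<Phi> = "\<lambda>(\<zeta>, \<mu>). list_of_counts (insert_parts (count_list \<zeta>) (count_list \<mu>))"
  let ?D = "D_set \<eta>" and ?B = "B_set 1 A \<eta> (c + 1) (if r = c + 2 then c + 1 else r)"
  have "bij_betw (map_prod count_list count_list) (?D \<times> ?B) (distinct_set \<times> lower_set)"
    unfolding D_set_eq B_set_eq
    by (intro bij_betw_map_prod bij_betw_list_of_counts ballI)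
      (simp_all only: distinct_set_def lower_set_def admissible_def mem_Collect_eq)
  note bij_betw_trans[OF this bij_insert_parts]
  moreover have "bij_betw list_of_counts upper_set (B_bar 0 A \<eta> (c + 2) r)"
    unfolding B_bar_eq
    by (intro bij_betw_list_of_counts ballI)
      (simp only: upper_set_def admissible_def mem_Collect_eq)
  ultimately have "bij_betw (list_of_counts \<circ> ((\<lambda>(z, h). insert_parts z h) \<circ> map_prod count_list count_list))
      (?D \<times> ?B) (B_bar 0 A \<eta> (c + 2) r)"
    by (rule bij_betw_trans)
  moreover have "list_of_counts \<circ> ((\<lambda>(z, h). insert_parts z h) \<circ> map_prod count_list count_list) = ?\<Phi>"
    by auto
  ultimately have bij: "bij_betw ?\<Phi> (?D \<times> ?B) (B_bar 0 A \<eta> (c + 2) r)"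
    by simp
  have "weight (?\<Phi> (\<zeta>, \<mu>)) = sum_list \<zeta> + weight \<mu>" if \<zeta>: "\<zeta> \<in> ?D" and \<mu>: "\<mu> \<in> ?B" for \<zeta> \<mu>
  proof -
    let ?f = "insert_parts (count_list \<zeta>) (count_list \<mu>)"
    have z: "count_list \<zeta> \<in> distinct_set" and h: "count_list \<mu> \<in> lower_set"
      using \<zeta> \<mu> unfolding D_set_eq B_set_eq by auto
    have count: "count_list (list_of_counts ?f) = ?f"
      using admissible_insert_parts[OF h z]
      by (intro count_list_of_counts) (simp add: admissible_def)
    have "finite (fst ` set (list_of_counts ?f) \<union> set \<zeta> \<union> fst ` set \<mu>)" by simp
    then obtain N where "\<forall>n\<in>fst ` set (list_of_counts ?f) \<union> set \<zeta> \<union> fst ` set \<mu>. n \<le> N"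
      unfolding finite_nat_set_iff_bounded_le by blast
    then have N: "\<forall>y\<in>set (list_of_counts ?f). fst y \<le> N" "\<forall>n\<in>set \<zeta>. n \<le> N" "\<forall>y\<in>set \<mu>. fst y \<le> N"
      by auto
    have "weight (list_of_counts ?f) = (\<Sum>n\<le>N. (?f (n, False) + ?f (n, True)) * n)"
      using weight_eq_sum_count_list[OF N(1)] unfolding count .
    also have "\<dots> = sum_list \<zeta> + weight \<mu>"
      unfolding insert_parts_total[OF h z] sum_list_eq_sum_count_list[OF N(2)]
        weight_eq_sum_count_list[OF N(3)] sum.distrib[symmetric]
      by (rule sum.cong) (auto simp: algebra_simps)
    finally show ?thesis by simp
  qed
  then show ?thesis using bij by blast
qed

end

theorem theorem4p1:
  fixes l \<eta> k r :: nat and \<alpha> :: "nat \<Rightarrow> nat"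
  assumes "0 < \<eta>"
    and "\<forall>i\<in>{1..l}. 0 < \<alpha> i \<and> \<alpha> i < \<eta>"
    and "strict_mono_on {1..l} \<alpha>"
    and "\<forall>i\<in>{1..l}. \<alpha> i = \<eta> - \<alpha> (l + 1 - i)"
    and "k \<ge> r" and "r \<ge> l" and "l < k - 1"
  shows "\<exists>\<Phi>0 :: nat list \<times> part list \<Rightarrow> part list.
           bij_betw \<Phi>0
             (D_set \<eta> \<times> B_set 1 (\<alpha> ` {1..l}) \<eta> (k - 1) (r - (if r = k then 1 else 0)))
             (B_bar 0 (\<alpha> ` {1..l}) \<eta> k r) \<and>
           (\<forall>\<zeta>\<in>D_set \<eta>.
              \<forall>\<mu>\<in>B_set 1 (\<alpha> ` {1..l}) \<eta> (k - 1) (r - (if r = k then 1 else 0)).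
                weight (\<Phi>0 (\<zeta>, \<mu>)) = sum_list \<zeta> + weight \<mu>)"
proof (cases "r = 0")
  \<comment> \<open>With R = 0 condition (4) bounds a number of parts by -1, so both sets of
    overpartitions are empty.\<close>
  case True
  then show ?thesis using assms(7) by (simp add: B_set_def B_bar_def bij_betw_def)
next
  case False
  define c where "c = k - 2"
  have k: "k = c + 2" using assms(7) by (simp add: c_def)
  have k1: "k - 1 = c + 1" using k by simp
  have R: "r - (if r = k then 1 else 0) = (if r = c + 2 then c + 1 else r)" using k by simp
  have "card (\<alpha> ` {1..l}) \<le> l" using card_image_le[of "{1..l}" \<alpha>] by simp
  then interpret overpartition_params \<eta> c r "\<alpha> ` {1..l}"
    using assms False k by unfold_locales auto
  show ?thesis using ex_weight_preserving_bij unfolding k1 R unfolding k .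
qed

end
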